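(* Let $N\ge 2$ be an integer and let $m:\mathbb{T}\to\mathbb{C}$ be a measurable function such that $\frac1N\sum_{w:\,w^N=z}|m(w)|^2=1$ for almost all $z\in\mathbb{T}$, so that $(S_m\xi)(z)=m(z)\xi(z^N)$ defines an isometry $S_m$ on $L^2(\mathbb{T})$. Let $P_U$ be the projection onto the subspace corresponding to the unitary part of the Wold decomposition of $S_m$. Then $P_U$ is one- or zero-dimensional. Furthermore, $P_U$ is one-dimensional if and only if both of the following conditions are fulfilled: (a) $|m(z)|=1$ for almost all $z\in\mathbb{T}$; (b) there exist a measurable function $\xi:\mathbb{T}\to\mathbb{T}$ and a $\lambda\in\mathbb{T}$ such that $m(z)\xi(z^N)=\lambda\xi(z)$ for almost all $z\in\mathbb{T}$. In this case the range of $P_U$ is $\mathbb{C}\xi\subset L^2(\mathbb{T})$. In short, $S_m$ is a shift if and only if there exists no phase factor $\lambda\in\mathbb{T}$ such that $\bar\lambda m$ is a coboundary for the $z\mapsto z^N$ action with values in $\mathbb{T}$.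
   Context: $\mathbb{T}$ is the unit circle with normalized Haar measure. For an isometry $S$ on a Hilbert space $\mathcal{H}$, $P_U$ denotes the strong limit of the decreasing sequence of projections $S^kS^{*k}$ as $k\to\infty$; $SP_U$ is unitary on $P_U\mathcal{H}$, and this is the unitary part in the Wold decomposition $S=SP_U\oplus S(1-P_U)$. $S$ is called a shift if $\bigcap_{n}S^n\mathcal{H}=\{0\}$, i.e. $P_U=0$. A measurable function $c$ on $\mathbb{T}$ is a coboundary for the $z\mapsto z^N$ action with values in $\mathbb{T}$ if there is a measurable $\Delta:\mathbb{T}\to\mathbb{T}$ with $c(z)=\Delta(z)\Delta(z^N)^{-1}$ for almost all $z$. *)

theory Defs
  imports "HOL-Analysis.Analysis"
begin

text \<open>
  The unit circle, as a subset of the complex plane, with its Borel sets and its normalized Haar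
  measure, i.e. the image of Lebesgue measure on \<open>[0,1)\<close> under \<open>t \<mapsto> exp (2 \<pi> i t)\<close>. Functions
  on the circle are represented by functions on \<open>complex\<close>; their values off the circle are
  irrelevant for everything below.
\<close>

definition circle :: "complex measure" where
  "circle = distr (restrict_space lborel {0..<1}) (restrict_space borel (sphere 0 1))
     (\<lambda>t::real. cis (2 * pi * t))"

lemma space_circle [simp]: "space circle = sphere 0 1"
  by (simp add: circle_def space_restrict_space)

lemma sets_circle: "sets circle = sets (restrict_space borel (sphere 0 1))"
  by (simp add: circle_def)

definition square_integrable :: "(complex \<Rightarrow> complex) \<Rightarrow> bool" where
  "square_integrable f \<longleftrightarrow>
     f \<in> borel_measurable circle \<and> integrable circle (\<lambda>z. (cmod (f z))\<^sup>2)"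

lemma square_integrable_zero: "square_integrable (\<lambda>_. 0)"
  by (simp add: square_integrable_def)

lemma square_integrable_add:
  assumes "square_integrable f" "square_integrable g"
  shows "square_integrable (\<lambda>z. f z + g z)"
proof -
  have [measurable]: "f \<in> borel_measurable circle" "g \<in> borel_measurable circle"
    using assms by (auto simp: square_integrable_def)
  have "integrable circle (\<lambda>z. 2 * (cmod (f z))\<^sup>2 + 2 * (cmod (g z))\<^sup>2)"
    using assms by (auto simp: square_integrable_def)
  then have "integrable circle (\<lambda>z. (cmod (f z + g z))\<^sup>2)"
  proof (rule Bochner_Integration.integrable_bound)
    have "(cmod (a + b))\<^sup>2 \<le> 2 * (cmod a)\<^sup>2 + 2 * (cmod b)\<^sup>2" for a b
    proof -
      have "(cmod (a + b))\<^sup>2 \<le> (cmod a + cmod b)\<^sup>2"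
        by (intro power_mono norm_triangle_ineq norm_ge_zero)
      also have "\<dots> \<le> 2 * (cmod a)\<^sup>2 + 2 * (cmod b)\<^sup>2"
        using sum_squares_bound[of "cmod a" "cmod b"] by (simp add: power2_sum)
      finally show ?thesis .
    qed
    then show "AE z in circle. norm ((cmod (f z + g z))\<^sup>2)
        \<le> norm (2 * (cmod (f z))\<^sup>2 + 2 * (cmod (g z))\<^sup>2)"
      by auto
  qed measurable
  then show ?thesis
    by (simp add: square_integrable_def)
qed

lemma square_integrable_scale:
  assumes "square_integrable f"
  shows "square_integrable (\<lambda>z. c * f z)"
  using assms by (auto simp: square_integrable_def norm_mult power_mult_distrib)

lemma integrable_mult_cnj:
  assumes "square_integrable f" "square_integrable g"
  shows "integrable circle (\<lambda>z. f z * cnj (g z))"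
proof -
  have [measurable]: "f \<in> borel_measurable circle" "g \<in> borel_measurable circle"
    using assms by (auto simp: square_integrable_def)
  have [measurable]: "(\<lambda>z. cnj (g z)) \<in> borel_measurable circle"
    by (rule measurable_compose[OF _ borel_measurable_continuous_onI])
      (auto intro: continuous_intros)
  have "integrable circle (\<lambda>z. (cmod (f z))\<^sup>2 + (cmod (g z))\<^sup>2)"
    using assms by (auto simp: square_integrable_def)
  then show ?thesis
  proof (rule Bochner_Integration.integrable_bound)
    have "cmod a * cmod b \<le> (cmod a)\<^sup>2 + (cmod b)\<^sup>2" for a b
    proof -
      have "0 \<le> cmod a * cmod b"
        by simp
      then show ?thesis
        using sum_squares_bound[of "cmod a" "cmod b"] unfolding mult.assoc by linarith
    qed
    then show "AE z in circle. norm (f z * cnj (g z)) \<le> norm ((cmod (f z))\<^sup>2 + (cmod (g z))\<^sup>2)"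
      by (auto simp: norm_mult)
  qed measurable
qed

definition l2_eq :: "(complex \<Rightarrow> complex) \<Rightarrow> (complex \<Rightarrow> complex) \<Rightarrow> bool" where
  "l2_eq f g \<longleftrightarrow> square_integrable f \<and> square_integrable g \<and> (AE z in circle. f z = g z)"

text \<open>The Hilbert space $L^2$ of the circle, with complex scalars.\<close>

quotient_type l2_circle = "complex \<Rightarrow> complex" / partial: l2_eq
proof (rule part_equivpI)
  show "\<exists>f. l2_eq f f"
    using square_integrable_zero by (auto simp: l2_eq_def)
  show "symp l2_eq"
    by (auto simp: symp_def l2_eq_def)
  show "transp l2_eq"
    by (auto simp: transp_def l2_eq_def)
qed

lift_definition scaleC :: "complex \<Rightarrow> l2_circle \<Rightarrow> l2_circle" (infixr "*\<^sub>C" 75)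
  is "\<lambda>c f z. c * f z"
  by (auto simp: l2_eq_def square_integrable_scale)

lift_definition cinner :: "l2_circle \<Rightarrow> l2_circle \<Rightarrow> complex"
  is "\<lambda>f g. \<integral>z. f z * cnj (g z) \<partial>circle"
  by (rule integral_cong_AE)
    (auto simp: l2_eq_def intro!: borel_measurable_integrable integrable_mult_cnj)

text \<open>
  The real structure is that of the underlying real Hilbert space; its inner product is the real
  part of \<open>cinner\<close>, so that norm and topology are those of $L^2$.
\<close>

instantiation l2_circle :: real_inner
begin

lift_definition zero_l2_circle :: l2_circle is "\<lambda>_. 0"
  by (simp add: l2_eq_def square_integrable_zero)

lift_definition plus_l2_circle :: "l2_circle \<Rightarrow> l2_circle \<Rightarrow> l2_circle"
  is "\<lambda>f g z. f z + g z"
  by (auto simp: l2_eq_def square_integrable_add)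

definition uminus_l2_circle :: "l2_circle \<Rightarrow> l2_circle" where
  "- f = (- 1) *\<^sub>C f"

definition minus_l2_circle :: "l2_circle \<Rightarrow> l2_circle \<Rightarrow> l2_circle" where
  "f - g = f + - (g :: l2_circle)"

definition scaleR_l2_circle :: "real \<Rightarrow> l2_circle \<Rightarrow> l2_circle" where
  "r *\<^sub>R f = complex_of_real r *\<^sub>C f"

definition inner_l2_circle :: "l2_circle \<Rightarrow> l2_circle \<Rightarrow> real" where
  "f \<bullet> g = Re (cinner f g)"

definition norm_l2_circle :: "l2_circle \<Rightarrow> real" where
  "norm f = sqrt (f \<bullet> (f :: l2_circle))"

definition dist_l2_circle :: "l2_circle \<Rightarrow> l2_circle \<Rightarrow> real" where
  "dist f g = norm (f - (g :: l2_circle))"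

definition sgn_l2_circle :: "l2_circle \<Rightarrow> l2_circle" where
  "sgn f = inverse (norm f) *\<^sub>R (f :: l2_circle)"

definition uniformity_l2_circle :: "(l2_circle \<times> l2_circle) filter" where
  "uniformity_l2_circle = (INF e\<in>{0<..}. principal {(x, y). dist x y < e})"

definition open_l2_circle :: "l2_circle set \<Rightarrow> bool" where
  "open_l2_circle U \<longleftrightarrow> (\<forall>x\<in>U. \<forall>\<^sub>F (x', y) in uniformity. x' = x \<longrightarrow> y \<in> U)"

instance
proof
  fix f g h :: l2_circle and r s :: real
  have scale_add: "(c + d) *\<^sub>C f = c *\<^sub>C f + d *\<^sub>C f" for c d
    by transfer (auto simp: l2_eq_def distrib_right
        intro!: square_integrable_add square_integrable_scale)
  have scale_one: "1 *\<^sub>C f = f"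
    by transfer (simp add: l2_eq_def)
  have scale_zero: "0 *\<^sub>C f = 0"
    by transfer (simp add: l2_eq_def square_integrable_zero)
  show "f + g + h = f + (g + h)"
    by transfer (auto simp: l2_eq_def add.assoc intro!: square_integrable_add)
  show "f + g = g + f"
    by transfer (auto simp: l2_eq_def add.commute intro!: square_integrable_add)
  show "0 + f = f"
    by transfer (auto simp: l2_eq_def)
  show "- f + f = 0"
    using scale_add[of "-1" 1] by (simp add: uminus_l2_circle_def scale_one scale_zero)
  show "f - g = f + - g"
    by (rule minus_l2_circle_def)
  show "r *\<^sub>R (f + g) = r *\<^sub>R f + r *\<^sub>R g"
    unfolding scaleR_l2_circle_def
    by transfer (auto simp: l2_eq_def distrib_left
        intro!: square_integrable_add square_integrable_scale)
  show "(r + s) *\<^sub>R f = r *\<^sub>R f + s *\<^sub>R f"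
    by (simp add: scaleR_l2_circle_def scale_add)
  show "r *\<^sub>R s *\<^sub>R f = (r * s) *\<^sub>R f"
    unfolding scaleR_l2_circle_def
    by transfer (auto simp: l2_eq_def mult.assoc intro!: square_integrable_scale)
  show "1 *\<^sub>R f = f"
    by (simp add: scaleR_l2_circle_def scale_one)
  show "f \<bullet> g = g \<bullet> f"
    unfolding inner_l2_circle_def
  proof transfer
    fix f g
    assume "l2_eq f f" "l2_eq g g"
    have "(\<integral>z. g z * cnj (f z) \<partial>circle) = (\<integral>z. cnj (f z * cnj (g z)) \<partial>circle)"
      by (simp add: mult.commute)
    also have "\<dots> = cnj (\<integral>z. f z * cnj (g z) \<partial>circle)"
      by (rule Bochner_Integration.integral_cnj)
    finally show "Re (\<integral>z. f z * cnj (g z) \<partial>circle) = Re (\<integral>z. g z * cnj (f z) \<partial>circle)"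
      by simp
  qed
  show "(f + g) \<bullet> h = f \<bullet> h + g \<bullet> h"
    unfolding inner_l2_circle_def
    by transfer (simp add: l2_eq_def distrib_right integrable_mult_cnj)
  show "r *\<^sub>R f \<bullet> g = r * (f \<bullet> g)"
    unfolding inner_l2_circle_def scaleR_l2_circle_def
    by transfer (simp add: mult.assoc)
  have self: "cinner f f = complex_of_real (Re (cinner f f)) \<and> 0 \<le> Re (cinner f f)
      \<and> (Re (cinner f f) = 0 \<longleftrightarrow> f = 0)"
  proof transfer
    fix f
    assume "l2_eq f f"
    then have sq: "square_integrable f"
      by (simp add: l2_eq_def)
    then have [measurable]: "f \<in> borel_measurable circle"
      and int: "integrable circle (\<lambda>z. (cmod (f z))\<^sup>2)"
      by (auto simp: square_integrable_def)
    have "(\<integral>z. f z * cnj (f z) \<partial>circle) = (\<integral>z. complex_of_real ((cmod (f z))\<^sup>2) \<partial>circle)"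
      by (simp only: complex_norm_square)
    also have "\<dots> = complex_of_real (\<integral>z. (cmod (f z))\<^sup>2 \<partial>circle)"
      by (rule integral_of_real[OF int])
    finally have eq: "(\<integral>z. f z * cnj (f z) \<partial>circle)
        = complex_of_real (\<integral>z. (cmod (f z))\<^sup>2 \<partial>circle)" .
    have "(\<integral>z. (cmod (f z))\<^sup>2 \<partial>circle) = 0 \<longleftrightarrow> (AE z in circle. (cmod (f z))\<^sup>2 = 0)"
      by (rule integral_nonneg_eq_0_iff_AE[OF int]) simp
    then show "(\<integral>z. f z * cnj (f z) \<partial>circle)
          = complex_of_real (Re (\<integral>z. f z * cnj (f z) \<partial>circle))
        \<and> 0 \<le> Re (\<integral>z. f z * cnj (f z) \<partial>circle)
        \<and> (Re (\<integral>z. f z * cnj (f z) \<partial>circle) = 0 \<longleftrightarrow> l2_eq f (\<lambda>_. 0))"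
      using sq int by (simp add: eq l2_eq_def square_integrable_zero)
  qed
  then show "0 \<le> f \<bullet> f" "f \<bullet> f = 0 \<longleftrightarrow> f = 0"
    by (auto simp: inner_l2_circle_def)
qed (auto simp: norm_l2_circle_def dist_l2_circle_def sgn_l2_circle_def uniformity_l2_circle_def
    open_l2_circle_def)

end

global_interpretation l2: vector_space scaleC
proof
  fix a b :: complex and x y :: l2_circle
  show "a *\<^sub>C (x + y) = a *\<^sub>C x + a *\<^sub>C y"
    by transfer (auto simp: l2_eq_def distrib_left
        intro!: square_integrable_add square_integrable_scale)
  show "(a + b) *\<^sub>C x = a *\<^sub>C x + b *\<^sub>C x"
    by transfer (auto simp: l2_eq_def distrib_right
        intro!: square_integrable_add square_integrable_scale)
  show "a *\<^sub>C b *\<^sub>C x = (a * b) *\<^sub>C x"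
    by transfer (auto simp: l2_eq_def mult.assoc intro!: square_integrable_scale)
  show "1 *\<^sub>C x = x"
    by transfer (simp add: l2_eq_def)
qed

text \<open>
  \<open>has_dim V n\<close>: the set \<open>V\<close> is a complex subspace of dimension \<open>n\<close>. (The library's \<open>dim\<close> is no
  substitute, since it is \<open>0\<close> on infinite-dimensional spaces.)
\<close>

definition has_dim :: "l2_circle set \<Rightarrow> nat \<Rightarrow> bool" where
  "has_dim V n \<longleftrightarrow>
     (\<exists>B. finite B \<and> card B = n \<and> \<not> l2.dependent B \<and> l2.span B = V)"

definition isometry :: "(l2_circle \<Rightarrow> l2_circle) \<Rightarrow> bool" where
  "isometry S \<longleftrightarrow> Vector_Spaces.linear scaleC scaleC S \<and> (\<forall>f. norm (S f) = norm f)"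

definition cadjoint :: "(l2_circle \<Rightarrow> l2_circle) \<Rightarrow> l2_circle \<Rightarrow> l2_circle" where
  "cadjoint S = (THE T. \<forall>f g. cinner (S f) g = cinner f (T g))"

text \<open>The projection \<open>P\<^sub>U\<close> onto the unitary part of the Wold decomposition of an isometry.\<close>

definition wold_unitary_proj :: "(l2_circle \<Rightarrow> l2_circle) \<Rightarrow> l2_circle \<Rightarrow> l2_circle" where
  "wold_unitary_proj S f = lim (\<lambda>k. (S ^^ k) ((cadjoint S ^^ k) f))"

definition is_shift :: "(l2_circle \<Rightarrow> l2_circle) \<Rightarrow> bool" where
  "is_shift S \<longleftrightarrow> (\<Inter>n. range (S ^^ n)) = {0}"

text \<open>
  The operator \<open>S\<^sub>m\<close> with \<open>(S\<^sub>m \<xi>)(z) = m(z) \<xi>(z^N)\<close>. It is defined through the chosen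
  representative \<open>rep_l2_circle \<xi>\<close> of the class \<open>\<xi>\<close>; that the choice is immaterial and that the
  product is square integrable depends on the normalization of \<open>m\<close>.
\<close>

definition weighted_comp :: "nat \<Rightarrow> (complex \<Rightarrow> complex) \<Rightarrow> l2_circle \<Rightarrow> l2_circle" where
  "weighted_comp N m \<xi> = abs_l2_circle (\<lambda>z. m z * rep_l2_circle \<xi> (z ^ N))"

text \<open>Measurable maps from \<open>circle\<close> to \<open>circle\<close> are those with values of modulus 1 on the circle.\<close>

definition coboundary :: "nat \<Rightarrow> (complex \<Rightarrow> complex) \<Rightarrow> bool" where
  "coboundary N c \<longleftrightarrow>
     (\<exists>\<Delta> \<in> measurable circle circle. AE z in circle. c z = \<Delta> z * inverse (\<Delta> (z ^ N)))"

end

theory Submission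
  imports Defs
begin

text \<open>
  For integrable \<open>h\<close> the averages \<open>root_avg n h\<close> over \<open>n\<close>-th roots converge in $L^1$ to the
  integral of \<open>h\<close>. If \<open>x = S\<^sup>k \<xi>\<^sub>k\<close> and \<open>y = S\<^sup>k \<eta>\<^sub>k\<close> for all \<open>k\<close>, then the normalization of
  \<open>m\<close> gives \<open>root_avg (N^k) (x * cnj y) = \<xi>\<^sub>k * cnj \<eta>\<^sub>k\<close>, so these products tend to the constant
  \<open>cinner x y\<close> in $L^1$. Orthogonal unit vectors in the unitary part are therefore impossible, because
  \<open>|\<xi>\<^sub>k|\<^sup>2\<close> and \<open>|\<eta>\<^sub>k|\<^sup>2\<close> would tend to 1 while \<open>\<xi>\<^sub>k * cnj \<eta>\<^sub>k\<close> tends to 0. If the unitary part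
  is spanned by a unit vector \<open>x\<close>, then \<open>S x = \<lambda> x\<close>; taking \<open>\<xi>\<^sub>k = \<lambda>\<^sup>-\<^sup>k x\<close> shows that \<open>|x|\<^sup>2\<close> is constant,
  and then \<open>|m| = 1\<close>.
\<close>

section \<open>Haar measure and averages over roots\<close>

text \<open>The obstacle is that \<open>m\<close> may vanish, so preimages under powers of the
  operator cannot be found by dividing by \<open>m\<close>. What remains accessible are products
  averaged over a fibre of the power map: there the phases of \<open>m\<close> cancel and its
  squared modulus averages to 1. Convergence of these averages rests on two facts. Averaging is an
  L1 contraction that preserves the integral, so approximable functions inherit convergence; and the
  \<open>n\<close>-th roots of a point are equally spaced, so counting those in an arc gives an
  error of at most 1/n, uniformly in the point. In the one-dimensional case S maps the line of
  \<open>x\<close> to itself, which yields the eigenvalue; isometry makes it unimodular, so the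
  squared moduli of the preimages do not depend on \<open>k\<close>, and a sequence that is both
  constant and convergent to a constant function settles the matter. Since the projection is defined
  as a limit of powers of S and its adjoint, identifying its range with the intersection of the
  ranges takes an explicit adjoint and the completeness of L2.\<close>

abbreviation turn :: "real \<Rightarrow> complex" where
  "turn t \<equiv> cis (2 * pi * t)"

lemma turn_power: "turn t ^ n = turn (real n * t)"
  by (simp add: Complex.DeMoivre mult_ac)

lemma measurable_turn [measurable]: "turn \<in> borel \<rightarrow>\<^sub>M circle"
  unfolding measurable_cong_sets [OF refl sets_circle]
  by (intro measurable_restrict_space2 borel_measurable_continuous_onI continuous_intros) auto

text \<open>The definition pushes forward into the restricted Borel space; with
  \<open>circle\<close> itself as target, the transfer rules for integrals apply directly to
  functions measurable on \<open>circle\<close>.\<close>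

lemma circle_eq_distr: "circle = distr (restrict_space lborel {0..<1}) circle turn"
proof -
  have "circle = distr (restrict_space lborel {0..<1}) (restrict_space borel (sphere 0 1)) turn"
    by (simp add: circle_def)
  also have "\<dots> = distr (restrict_space lborel {0..<1}) circle turn"
    by (rule distr_cong) (auto simp: sets_circle)
  finally show ?thesis .
qed

lemma measurable_turn_restrict: "turn \<in> restrict_space lborel {0..<1} \<rightarrow>\<^sub>M circle"
  by (rule measurable_restrict_space1) (use measurable_turn in simp)

lemma nn_integral_circle:
  assumes "h \<in> borel_measurable circle"
  shows "(\<integral>\<^sup>+z. h z \<partial>circle) = (\<integral>\<^sup>+t. h (turn t) * indicator {0..<1} t \<partial>lborel)"
  by (subst circle_eq_distr, subst nn_integral_distr [OF measurable_turn_restrict])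
     (simp_all add: assms nn_integral_restrict_space)

lemma integrable_circle_iff:
  fixes h :: "complex \<Rightarrow> 'a::{banach, second_countable_topology}"
  assumes "h \<in> borel_measurable circle"
  shows "integrable circle h \<longleftrightarrow> integrable lborel (\<lambda>t. indicator {0..<1} t *\<^sub>R h (turn t))"
  by (subst circle_eq_distr, subst integrable_distr_eq [OF measurable_turn_restrict])
     (simp_all add: assms integrable_restrict_space)

lemma integral_circle:
  fixes h :: "complex \<Rightarrow> 'a::{banach, second_countable_topology}"
  assumes "h \<in> borel_measurable circle"
  shows "(\<integral>z. h z \<partial>circle) = (\<integral>t. indicator {0..<1} t *\<^sub>R h (turn t) \<partial>lborel)"
  by (subst circle_eq_distr, subst integral_distr [OF measurable_turn_restrict])
     (simp_all add: assms integral_restrict_space)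

lemma emeasure_circle: "emeasure circle (sphere 0 1) = 1"
proof -
  have "emeasure circle (space circle) = (\<integral>\<^sup>+z. 1 \<partial>circle)"
    by simp
  also have "\<dots> = 1"
    by (subst nn_integral_circle) auto
  finally show ?thesis
    by simp
qed

lemma finite_measure_circle: "finite_measure circle"
  by (rule finite_measureI) (simp add: emeasure_circle)

lemma measure_circle [simp]: "measure circle (sphere 0 1) = 1"
  by (simp add: measure_def emeasure_circle)

lemma integrable_circle_const [simp]:
  "integrable circle (\<lambda>z. c :: 'a::{banach, second_countable_topology})"
  by (rule finite_measure.integrable_const [OF finite_measure_circle])

text \<open>A Borel choice of angle. Composing with it recovers a function on the circle from its
  lift to the line.\<close>

lemma turn_section:
  obtains s where "s \<in> borel_measurable borel" "\<And>z. cmod z = 1 \<Longrightarrow> turn (s z) = z"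
proof
  \<comment> \<open>Clamping the real part keeps the argument of \<open>arccos\<close> in [-1,1] at
    every complex number, so \<open>a\<close> is continuous everywhere; the sign of
    \<open>Im z\<close> then selects the half circle.\<close>
  define a where "a z = arccos (max (-1) (min 1 (Re z)))" for z
  let ?s = "\<lambda>z. (if Im z \<ge> 0 then a z else - a z) / (2 * pi)"
  have [measurable]: "a \<in> borel_measurable borel"
    unfolding a_def by (intro borel_measurable_continuous_onI continuous_intros) auto
  show "?s \<in> borel_measurable borel"
    by measurable
  show "turn (?s z) = z" if "cmod z = 1" for z
  proof -
    have *: "(Re z)\<^sup>2 + (Im z)\<^sup>2 = 1"
      using that by (simp add: cmod_def)
    have "\<bar>Re z\<bar> \<le> 1"
      using abs_Re_le_cmod [of z] that by simp
    then have "a z = arccos (Re z)" "cos (a z) = Re z"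
      by (simp_all add: a_def min_absorb2 max_absorb2 abs_le_iff)
    moreover have "sin (a z) = \<bar>Im z\<bar>"
      using * \<open>\<bar>Re z\<bar> \<le> 1\<close> \<open>a z = arccos (Re z)\<close> by (simp add: sin_arccos_abs flip: real_sqrt_abs)
    ultimately show ?thesis
      by (simp add: complex_eq_iff)
  qed
qed

text \<open>For the converse, \<open>f\<close> agrees on the circle with its lift composed with the
  section. Questions of measurability thereby move to the line, where taking roots is an affine map
  of angles.\<close>

lemma measurable_circle_iff:
  "f \<in> circle \<rightarrow>\<^sub>M M \<longleftrightarrow> (\<lambda>t. f (turn t)) \<in> borel \<rightarrow>\<^sub>M M"
proof
  show "(\<lambda>t. f (turn t)) \<in> borel \<rightarrow>\<^sub>M M" if "f \<in> circle \<rightarrow>\<^sub>M M"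
    by (rule measurable_compose [OF measurable_turn that])
next
  assume *: "(\<lambda>t. f (turn t)) \<in> borel \<rightarrow>\<^sub>M M"
  obtain s where s: "s \<in> borel_measurable borel" "\<And>z. cmod z = 1 \<Longrightarrow> turn (s z) = z"
    using turn_section by blast
  have "s \<in> borel_measurable circle"
    using s(1) unfolding measurable_cong_sets [OF sets_circle refl] by (rule measurable_restrict_space1)
  from measurable_compose [OF this *] show "f \<in> circle \<rightarrow>\<^sub>M M"
    by (rule measurable_cong [THEN iffD1, rotated]) (simp add: s(2))
qed

section \<open>Fibres of the power map and averages over them\<close>

lemma nth_roots_turn:
  assumes "n > 0"
  shows "bij_betw (\<lambda>j. turn ((t + real j) / real n)) {..<n} {w. w ^ n = turn t}"
proof -
  \<comment> \<open>One root suffices: the others are its products with the roots of unity, whose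
    angles are the fractions j/n of a turn.\<close>
  define r where "r = turn (t / real n)"
  have r: "r ^ n = turn t" "r \<noteq> 0"
    using assms unfolding r_def turn_power by simp_all
  have "bij_betw (\<lambda>w. r * w) {w. w ^ n = 1} {w. w ^ n = turn t}"
    by (rule bij_betwI [where g = "\<lambda>w. w / r"])
       (auto simp: power_mult_distrib power_divide r)
  from bij_betw_trans [OF Complex.bij_betw_roots_unity [OF assms] this]
  show ?thesis
    by (simp add: o_def r_def cis_mult add_divide_distrib distrib_left mult.assoc)
qed

text \<open>The transfer operator of the power map, adjoint to composition with the
  \<open>n\<close>-th power. Vector values let it act on complex functions and on their norms alike;
  for \<open>n = 0\<close> it is 0.\<close>

definition root_avg :: "nat \<Rightarrow> (complex \<Rightarrow> 'a::real_vector) \<Rightarrow> complex \<Rightarrow> 'a" where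
  "root_avg n h z = (1 / real n) *\<^sub>R (\<Sum>w | w ^ n = z. h w)"

lemma sum_roots_turn:
  assumes "n > 0"
  shows "(\<Sum>w | w ^ n = turn t. h w) = (\<Sum>j<n. h (turn ((t + real j) / real n)))"
  by (rule sum.reindex_bij_betw [OF nth_roots_turn [OF assms], symmetric])

lemma root_norm_1:
  assumes "w ^ n = z" "cmod z = 1" "n > 0"
  shows "cmod w = 1"
proof -
  have "cmod w ^ n = 1"
    using assms by (simp flip: norm_power)
  then show ?thesis
    using \<open>n > 0\<close> power_eq_imp_eq_base [of "cmod w" n 1] by simp
qed

lemma measurable_power_circle [measurable]: "(\<lambda>z. z ^ n) \<in> circle \<rightarrow>\<^sub>M circle"
  unfolding measurable_circle_iff turn_power by measurable

lemma measurable_sum_roots: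
  fixes h :: "complex \<Rightarrow> 'a::{second_countable_topology, topological_comm_monoid_add}"
  assumes h: "h \<in> borel_measurable circle" and "n > 0"
  shows "(\<lambda>z. \<Sum>w | w ^ n = z. h w) \<in> borel_measurable circle"
proof -
  have [measurable]: "(\<lambda>t. h (turn t)) \<in> borel_measurable borel"
    using h by (simp add: measurable_circle_iff)
  have "(\<lambda>t. h (turn ((t + real j) / real n))) \<in> borel_measurable borel" for j
    by measurable
  then show ?thesis
    using \<open>n > 0\<close> by (simp add: measurable_circle_iff sum_roots_turn)
qed

lemma measurable_root_avg:
  fixes h :: "complex \<Rightarrow> 'a::{second_countable_topology, real_normed_vector}"
  assumes "h \<in> borel_measurable circle" and "n > 0"
  shows "root_avg n h \<in> borel_measurable circle"
  unfolding root_avg_def [abs_def]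
  by (intro borel_measurable_scaleR measurable_sum_roots assms) auto

section \<open>Change of variables between a fibre and the whole circle\<close>

lemma unit_interval_shift:
  assumes "real n * x - real j \<in> {0..<1}" "j < n"
  shows "x \<in> {0..<1}"
proof -
  have "0 \<le> real n * x - real j" "real n * x - real j < 1" "real j + 1 \<le> real n"
    using assms(1) by (simp_all only: atLeastLessThan_iff) (use assms(2) in linarith)
  then have "0 \<le> real n * x" "real n * x < real n * 1" "real n > 0"
    by linarith+
  moreover from this have "x < 1"
    using mult_less_cancel_left_pos by blast
  ultimately show ?thesis
    by (auto simp: zero_le_mult_iff)
qed

text \<open>The \<open>j\<close>-th term tests whether \<open>x\<close> lies in the
  \<open>j\<close>-th of \<open>n\<close> equal pieces of [0,1). For \<open>x\<close> in [0,1) only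
  the integer part of \<open>n x\<close> qualifies; for other \<open>x\<close> no index
  does.\<close>

lemma sum_indicator_shift:
  assumes "n > 0"
  shows "(\<Sum>j<n. indicator {0..<1} (real n * x - real j)) =
    (indicator {0..<1} x :: 'a::comm_semiring_1)"
proof (cases "x \<in> {0..<1}")
  case True
  have "nat \<lfloor>real n * x\<rfloor> < n"
    using True assms by (simp add: nat_less_iff floor_less_iff)
  have "real n * x - real j \<in> {0..<1} \<longleftrightarrow> j = nat \<lfloor>real n * x\<rfloor>" for j
    using True assms by (auto simp: eq_nat_nat_iff nat_eq_iff2) linarith+
  then have "(\<Sum>j<n. indicator {0..<1} (real n * x - real j)) =
      (\<Sum>j<n. if j = nat \<lfloor>real n * x\<rfloor> then 1 else (0::'a))"
    by (intro sum.cong) (auto simp: indicator_def)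
  also have "\<dots> = 1"
    using \<open>nat _ < n\<close> by simp
  finally show ?thesis
    using True by simp
next
  case False
  then have "real n * x - real j \<notin> {0..<1}" if "j < n" for j
    using unit_interval_shift that by blast
  then show ?thesis
    using False by simp
qed

text \<open>The \<open>j\<close>-th branch of the root maps [0,1) onto the \<open>j\<close>-th
  piece, and undoing it contributes the Jacobian \<open>n\<close>; the pieces then reassemble to
  [0,1). The version for nonnegative functions serves null sets and functions not yet known to be
  integrable.\<close>

lemma nn_integral_sum_roots:
  fixes h :: "complex \<Rightarrow> ennreal"
  assumes h: "h \<in> borel_measurable circle" and "n > 0"
  shows "(\<integral>\<^sup>+z. (\<Sum>w | w ^ n = z. h w) \<partial>circle) = of_nat n * (\<integral>\<^sup>+z. h z \<partial>circle)"
proof -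
  have [measurable]: "(\<lambda>t. h (turn t)) \<in> borel_measurable borel"
    using h by (simp add: measurable_circle_iff)
  have shift [measurable]: "(\<lambda>t. h (turn ((t + real j) / real n)) * indicator {0..<1} t)
      \<in> borel_measurable borel" for j
    by measurable
  have "(\<integral>\<^sup>+z. (\<Sum>w | w ^ n = z. h w) \<partial>circle) =
      (\<integral>\<^sup>+t. (\<Sum>j<n. h (turn ((t + real j) / real n)) * indicator {0..<1} t) \<partial>lborel)"
    by (subst nn_integral_circle)
       (auto intro!: measurable_sum_roots assms simp: sum_roots_turn sum_distrib_right \<open>n > 0\<close>)
  also have "\<dots> = (\<Sum>j<n. \<integral>\<^sup>+t. h (turn ((t + real j) / real n)) * indicator {0..<1} t \<partial>lborel)"
    by (rule nn_integral_sum) measurable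
  also have "\<dots> = (\<Sum>j<n. of_nat n *
      (\<integral>\<^sup>+t. h (turn t) * indicator {0..<1} (real n * t - real j) \<partial>lborel))"
  proof (rule sum.cong [OF refl])
    fix j
    show "(\<integral>\<^sup>+t. h (turn ((t + real j) / real n)) * indicator {0..<1} t \<partial>lborel) =
        of_nat n * (\<integral>\<^sup>+t. h (turn t) * indicator {0..<1} (real n * t - real j) \<partial>lborel)"
      by (subst nn_integral_real_affine [OF shift, where c = "real n" and t = "- real j"])
         (use \<open>n > 0\<close> in \<open>simp_all add: ennreal_of_nat_eq_real_of_nat\<close>)
  qed
  also have "\<dots> = of_nat n *
      (\<integral>\<^sup>+t. (\<Sum>j<n. h (turn t) * indicator {0..<1} (real n * t - real j)) \<partial>lborel)"
    by (subst nn_integral_sum) (auto simp: sum_distrib_left)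
  also have "\<dots> = of_nat n * (\<integral>\<^sup>+z. h z \<partial>circle)"
    by (simp add: nn_integral_circle h sum_indicator_shift \<open>n > 0\<close> flip: sum_distrib_left)
  finally show ?thesis .
qed

text \<open>The same substitution for vector-valued functions, where integrability has to be carried
  along for each branch; the factor 1/n cancels the Jacobian.\<close>

lemma has_bochner_integral_root_avg:
  fixes h :: "complex \<Rightarrow> 'a::{banach, second_countable_topology}"
  assumes h: "integrable circle h" and "n > 0"
  shows "has_bochner_integral circle (root_avg n h) (\<integral>z. h z \<partial>circle)"
proof -
  have m: "h \<in> borel_measurable circle"
    using h by auto
  then have [measurable]: "(\<lambda>t. h (turn t)) \<in> borel_measurable borel"
    by (simp add: measurable_circle_iff)
  let ?f = "\<lambda>j t. indicator {0..<1} t *\<^sub>R h (turn ((t + real j) / real n))"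
  let ?g = "\<lambda>j t. indicator {0..<1} (real n * t - real j) *\<^sub>R h (turn t)"
  have fg: "?f j (- real j + real n * t) = ?g j t" for j t
    using \<open>n > 0\<close> by simp
  \<comment> \<open>The lift of \<open>h\<close> is periodic and integrable only over [0,1), so the
    indicator of the piece is first multiplied by that of [0,1), which contains it.\<close>
  have g: "integrable lborel (?g j)" if "j < n" for j
  proof -
    have "integrable lborel (\<lambda>t. indicator {t. real n * t - real j \<in> {0..<1}} t *\<^sub>R
        (indicator {0..<1} t *\<^sub>R h (turn t)))"
      using h by (intro integrable_mult_indicator [OF _ h [unfolded integrable_circle_iff [OF m]]]) auto
    moreover have "indicator {t. real n * t - real j \<in> {0..<1}} t *\<^sub>R
        (indicator {0..<1} t *\<^sub>R h (turn t)) = ?g j t" for t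
      using unit_interval_shift [OF _ that, of t] by (auto simp: indicator_def)
    ultimately show ?thesis
      by (simp only:)
  qed
  have f: "integrable lborel (?f j)" if "j < n" for j
    using g [OF that] \<open>n > 0\<close>
    by (subst lborel_integrable_real_affine_iff [where c = "real n" and t = "- real j", symmetric])
       (auto simp: fg)
  have eq: "(\<integral>t. ?f j t \<partial>lborel) = real n *\<^sub>R (\<integral>t. ?g j t \<partial>lborel)" for j
    using \<open>n > 0\<close>
    by (subst lborel_integral_real_affine [where c = "real n" and t = "- real j"]) (auto simp: fg)
  have avg: "indicator {0..<1} t *\<^sub>R root_avg n h (turn t) = (1 / real n) *\<^sub>R (\<Sum>j<n. ?f j t)" for t
    using \<open>n > 0\<close> by (cases "t \<in> {0..<1}") (simp_all add: root_avg_def sum_roots_turn)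
  have "integrable lborel (\<lambda>t. (1 / real n) *\<^sub>R (\<Sum>j<n. ?f j t))"
    using f by (intro integrable_scaleR_right Bochner_Integration.integrable_sum) auto
  then have "integrable circle (root_avg n h)"
    by (simp only: integrable_circle_iff measurable_root_avg m \<open>n > 0\<close> avg)
  moreover have "(\<integral>z. root_avg n h z \<partial>circle) = (\<integral>z. h z \<partial>circle)"
  proof -
    have "(\<integral>z. root_avg n h z \<partial>circle) = (1 / real n) *\<^sub>R (\<integral>t. (\<Sum>j<n. ?f j t) \<partial>lborel)"
      by (simp only: integral_circle measurable_root_avg m \<open>n > 0\<close> avg integral_scaleR_right)
    also have "\<dots> = (1 / real n) *\<^sub>R (\<Sum>j<n. \<integral>t. ?f j t \<partial>lborel)"
      using f by (subst Bochner_Integration.integral_sum) auto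
    also have "\<dots> = (\<Sum>j<n. \<integral>t. ?g j t \<partial>lborel)"
      using \<open>n > 0\<close> unfolding eq by (simp flip: scaleR_sum_right)
    also have "\<dots> = (\<integral>t. (\<Sum>j<n. ?g j t) \<partial>lborel)"
      using g by (subst Bochner_Integration.integral_sum) auto
    also have "\<dots> = (\<integral>z. h z \<partial>circle)"
      by (simp add: integral_circle m sum_indicator_shift \<open>n > 0\<close> flip: scaleR_sum_left)
    finally show ?thesis .
  qed
  ultimately show ?thesis
    by (simp add: has_bochner_integral_iff)
qed

text \<open>If \<open>A\<close> is null, the number of roots of \<open>z\<close> in \<open>A\<close>
  has integral \<open>n\<close> times the measure of \<open>A\<close>, hence vanishes almost
  everywhere. This allows an almost-everywhere identity to be used at all points of a fibre at
  once.\<close>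

lemma AE_roots:
  assumes "AE z in circle. P z" "n > 0"
  shows "AE z in circle. \<forall>w. w ^ n = z \<longrightarrow> P w"
proof -
  obtain A where A: "{z \<in> space circle. \<not> P z} \<subseteq> A" "A \<in> null_sets circle"
    using assms(1) by (auto simp: eventually_ae_filter)
  then have [measurable]: "A \<in> sets circle"
    by auto
  have [measurable]: "(\<lambda>z. \<Sum>w | w ^ n = z. indicator A w :: ennreal) \<in> borel_measurable circle"
    using \<open>n > 0\<close> by (intro measurable_sum_roots) auto
  have "(\<integral>\<^sup>+z. (\<Sum>w | w ^ n = z. indicator A w) \<partial>circle) = 0"
    using A \<open>n > 0\<close> by (subst nn_integral_sum_roots) auto
  then have "AE z in circle. (\<Sum>w | w ^ n = z. indicator A w :: ennreal) = 0"
    by (subst (asm) nn_integral_0_iff_AE) auto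
  with AE_space show ?thesis
  proof eventually_elim
    case (elim z)
    then have "\<forall>w\<in>{w. w ^ n = z}. indicator A w = (0::ennreal)"
      using finite_nth_roots [OF \<open>n > 0\<close>] by (subst (asm) sum_nonneg_eq_0_iff) auto
    then have "w \<notin> A" if "w ^ n = z" for w
      using that by (auto simp: indicator_eq_0_iff)
    moreover have "cmod w = 1" if "w ^ n = z" for w
      using elim(1) that \<open>n > 0\<close> root_norm_1 by auto
    ultimately show ?case
      using A(1) by auto
  qed
qed

text \<open>The power map preserves the measure: \<open>indicator A (w ^ n)\<close> is constant on
  each fibre, and each fibre over the circle has \<open>n\<close> points. So preimages of null sets
  are null.\<close>

lemma AE_power:
  assumes "AE z in circle. P z" "n > 0"
  shows "AE z in circle. P (z ^ n)"
proof -
  obtain A where A: "{z \<in> space circle. \<not> P z} \<subseteq> A" "A \<in> null_sets circle"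
    using assms(1) by (auto simp: eventually_ae_filter)
  then have [measurable]: "A \<in> sets circle"
    by auto
  have "of_nat n * (\<integral>\<^sup>+z. indicator A (z ^ n) \<partial>circle) =
      (\<integral>\<^sup>+z. (\<Sum>w | w ^ n = z. indicator A (w ^ n)) \<partial>circle)"
    using \<open>n > 0\<close> by (subst nn_integral_sum_roots) auto
  also have "\<dots> = (\<integral>\<^sup>+z. of_nat (card {w. w ^ n = z}) * indicator A z \<partial>circle)"
    by (intro nn_integral_cong) simp
  also have "\<dots> = (\<integral>\<^sup>+z. of_nat n * indicator A z \<partial>circle)"
    using \<open>n > 0\<close> by (intro nn_integral_cong arg_cong2 [where f = "(*)"] refl)
      (auto intro!: arg_cong [where f = of_nat] card_nth_roots)
  also have "\<dots> = 0"
    using A by (subst nn_integral_cmult) auto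
  finally have "(\<integral>\<^sup>+z. indicator A (z ^ n) \<partial>circle) = 0"
    using \<open>n > 0\<close> by auto
  then have "AE z in circle. indicator A (z ^ n) = (0::ennreal)"
    by (subst (asm) nn_integral_0_iff_AE) auto
  with AE_space show ?thesis
  proof eventually_elim
    case (elim z)
    then have "z ^ n \<in> space circle" "z ^ n \<notin> A"
      by (auto simp: indicator_eq_0_iff norm_power)
    then show ?case
      using A(1) by blast
  qed
qed

text \<open>The roots of order \<open>a * b\<close> are grouped by their \<open>b\<close>-th
  power.\<close>

lemma root_avg_root_avg:
  assumes "a > 0" "b > 0"
  shows "root_avg a (root_avg b h) z = root_avg (a * b) h z"
proof -
  have "(\<Sum>w | w ^ a = z. \<Sum>v | v ^ b = w. h v) = (\<Sum>(w, v)\<in>(SIGMA w:{w. w ^ a = z}. {v. v ^ b = w}). h v)"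
    using assms by (intro sum.Sigma) auto
  also have "\<dots> = (\<Sum>v | v ^ (a * b) = z. h v)"
    by (rule sum.reindex_bij_witness [where i = "\<lambda>v. (v ^ b, v)" and j = snd])
       (auto simp: mult.commute [of a] power_mult)
  finally show ?thesis
    by (simp add: root_avg_def flip: scaleR_sum_right)
qed

lemma norm_root_avg_le: "norm (root_avg n h z) \<le> root_avg n (\<lambda>w. norm (h w)) z"
proof -
  have "norm (root_avg n h z) = (1 / real n) * norm (\<Sum>w | w ^ n = z. h w)"
    by (simp add: root_avg_def)
  also have "\<dots> \<le> (1 / real n) * (\<Sum>w | w ^ n = z. norm (h w))"
    by (intro mult_left_mono norm_sum) simp
  finally show ?thesis
    by (simp add: root_avg_def)
qed

lemma integrable_root_avg:
  fixes h :: "complex \<Rightarrow> 'a::{banach, second_countable_topology}"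
  assumes "integrable circle h" "n > 0"
  shows "integrable circle (root_avg n h)"
  using has_bochner_integral_root_avg [OF assms] by (simp add: has_bochner_integral_iff)

lemma integral_root_avg:
  fixes h :: "complex \<Rightarrow> 'a::{banach, second_countable_topology}"
  assumes "integrable circle h" "n > 0"
  shows "(\<integral>z. root_avg n h z \<partial>circle) = (\<integral>z. h z \<partial>circle)"
  using has_bochner_integral_root_avg [OF assms] by (rule has_bochner_integral_integral_eq)

text \<open>Uniform in \<open>n\<close>; this is what lets an L1 approximation survive the limit
  over \<open>n\<close>.\<close>

lemma root_avg_contraction:
  fixes h :: "complex \<Rightarrow> 'a::{banach, second_countable_topology}"
  assumes "integrable circle h" "n > 0"
  shows "(\<integral>z. norm (root_avg n h z) \<partial>circle) \<le> (\<integral>z. norm (h z) \<partial>circle)"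
proof -
  have "(\<integral>z. norm (root_avg n h z) \<partial>circle) \<le> (\<integral>z. root_avg n (\<lambda>w. norm (h w)) z \<partial>circle)"
    by (intro integral_mono integrable_norm integrable_root_avg assms norm_root_avg_le)
  also have "\<dots> = (\<integral>z. norm (h z) \<partial>circle)"
    by (intro integral_root_avg integrable_norm assms)
  finally show ?thesis .
qed

lemma root_avg_add: "root_avg n (\<lambda>z. f z + g z) z = root_avg n f z + root_avg n g z"
  by (simp add: root_avg_def sum.distrib scaleR_add_right)

lemma root_avg_diff: "root_avg n (\<lambda>z. f z - g z) z = root_avg n f z - root_avg n g z"
  by (simp add: root_avg_def sum_subtractf scaleR_diff_right)

lemma root_avg_scaleR: "root_avg n (\<lambda>z. f z *\<^sub>R c) z = root_avg n f z *\<^sub>R c"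
  by (simp add: root_avg_def flip: scaleR_sum_left)

lemma root_avg_const:
  assumes "z \<noteq> 0" "n > 0"
  shows "root_avg n (\<lambda>z. c) z = c"
  using assms by (simp add: root_avg_def card_nth_roots sum_constant_scaleR)

section \<open>Equidistribution of roots\<close>

text \<open>Integrability is kept separate: Bochner integrals of non-integrable functions default to
  0, so the property is meaningful only together with it, and the closure rules below carry
  both.\<close>

definition equidist :: "(complex \<Rightarrow> 'a::{banach, second_countable_topology}) \<Rightarrow> bool" where
  "equidist h \<longleftrightarrow>
     (\<lambda>n. \<integral>z. norm (root_avg n h z - (\<integral>w. h w \<partial>circle)) \<partial>circle) \<longlonglongrightarrow> 0"

text \<open>Closedness in L1 by a three-term estimate: the average of \<open>h - g\<close>, the
  deviation of \<open>g\<close> itself, and the difference of the two means. The contraction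
  property controls the first, the integral norm bound the last.\<close>

lemma equidistI:
  assumes "integrable circle h"
    and "\<And>e. e > 0 \<Longrightarrow>
      \<exists>g. integrable circle g \<and> equidist g \<and> (\<integral>z. norm (h z - g z) \<partial>circle) < e"
  shows "equidist h"
  unfolding equidist_def
proof (rule LIMSEQ_I)
  fix e :: real
  assume "e > 0"
  then obtain g where g: "integrable circle g" "equidist g" "(\<integral>z. norm (h z - g z) \<partial>circle) < e / 3"
    using assms(2) [of "e / 3"] by auto
  let ?H = "\<integral>w. h w \<partial>circle" and ?G = "\<integral>w. g w \<partial>circle"
  obtain M where M: "\<And>n. n \<ge> M \<Longrightarrow> (\<integral>z. norm (root_avg n g z - ?G) \<partial>circle) < e / 3"
    using LIMSEQ_D [OF g(2) [unfolded equidist_def], of "e / 3"] \<open>e > 0\<close>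
    by (auto simp: abs_less_iff)
  have d: "integrable circle (\<lambda>z. h z - g z)"
    using assms(1) g(1) by simp
  \<comment> \<open>Starting at \<open>Suc M\<close> excludes \<open>n = 0\<close>, where there is
    no average.\<close>
  have "norm ((\<integral>z. norm (root_avg n h z - ?H) \<partial>circle) - 0) < e" if "n \<ge> Suc M" for n
  proof -
    have "n > 0"
      using that by simp
    note [simp] = integrable_root_avg [OF assms(1) this] integrable_root_avg [OF g(1) this]
      integrable_root_avg [OF d this]
    have "(\<integral>z. norm (root_avg n h z - ?H) \<partial>circle) \<le>
        (\<integral>z. norm (root_avg n (\<lambda>z. h z - g z) z) + norm (root_avg n g z - ?G) + norm (?H - ?G) \<partial>circle)"
    proof (rule integral_mono)
      fix z
      have "root_avg n h z - ?H =
          root_avg n (\<lambda>z. h z - g z) z + (root_avg n g z - ?G) - (?H - ?G)"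
        by (simp add: root_avg_diff)
      also have "norm \<dots> \<le> norm (root_avg n (\<lambda>z. h z - g z) z) + norm (root_avg n g z - ?G) + norm (?H - ?G)"
        by (intro norm_triangle_le_diff add_right_mono norm_triangle_ineq)
      finally show "norm (root_avg n h z - ?H) \<le> \<dots>" .
    qed simp_all
    also have "\<dots> = (\<integral>z. norm (root_avg n (\<lambda>z. h z - g z) z) \<partial>circle) +
        (\<integral>z. norm (root_avg n g z - ?G) \<partial>circle) + norm (?H - ?G)"
      by simp
    also have "\<dots> < e / 3 + e / 3 + e / 3"
    proof (intro add_strict_mono)
      show "(\<integral>z. norm (root_avg n (\<lambda>z. h z - g z) z) \<partial>circle) < e / 3"
        using root_avg_contraction [OF d \<open>n > 0\<close>] g(3) by simp
      show "(\<integral>z. norm (root_avg n g z - ?G) \<partial>circle) < e / 3"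
        using M that by simp
      have "norm (?H - ?G) = norm (\<integral>z. h z - g z \<partial>circle)"
        using assms(1) g(1) by simp
      also have "\<dots> \<le> (\<integral>z. norm (h z - g z) \<partial>circle)"
        by (rule integral_norm_bound)
      finally show "norm (?H - ?G) < e / 3"
        using g(3) by simp
    qed
    finally show ?thesis
      by simp
  qed
  then show "\<exists>M. \<forall>n\<ge>M. norm ((\<integral>z. norm (root_avg n h z - ?H) \<partial>circle) - 0) < e"
    by blast
qed

text \<open>Dominated convergence turns pointwise approximation into L1 approximation. The factor 2
  matches the limit case of \<open>integrable_induct\<close>; the dominating function then needs the
  factor 3 = 1 + 2.\<close>

lemma equidist_lim:
  assumes h: "integrable circle h"
    and s: "\<And>i. integrable circle (s i)" "\<And>i. equidist (s i)"
    and lim: "\<And>z. z \<in> space circle \<Longrightarrow> (\<lambda>i. s i z) \<longlonglongrightarrow> h z"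
    and bound: "\<And>i z. z \<in> space circle \<Longrightarrow> norm (s i z) \<le> 2 * norm (h z)"
  shows "equidist h"
proof (rule equidistI [OF h])
  fix e :: real
  assume "e > 0"
  have "(\<lambda>i. \<integral>z. norm (h z - s i z) \<partial>circle) \<longlonglongrightarrow> (\<integral>z. 0 \<partial>circle)"
  proof (rule integral_dominated_convergence [where w = "\<lambda>z. 3 * norm (h z)"])
    show "AE z in circle. (\<lambda>i. norm (h z - s i z)) \<longlonglongrightarrow> 0"
    proof (rule AE_I2)
      fix z
      assume "z \<in> space circle"
      from tendsto_norm [OF tendsto_diff [OF tendsto_const lim [OF this]], of "h z"]
      show "(\<lambda>i. norm (h z - s i z)) \<longlonglongrightarrow> 0"
        by simp
    qed
    show "AE z in circle. norm (norm (h z - s i z)) \<le> 3 * norm (h z)" for i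
    proof (rule AE_I2)
      fix z
      assume "z \<in> space circle"
      from bound [OF this, of i] norm_triangle_ineq4 [of "h z" "s i z"]
      show "norm (norm (h z - s i z)) \<le> 3 * norm (h z)"
        by simp
    qed
  qed (use h s(1) in auto)
  then have "\<forall>\<^sub>F i in sequentially. (\<integral>z. norm (h z - s i z) \<partial>circle) < e"
    using \<open>e > 0\<close> by (intro order_tendstoD(2)) auto
  then show "\<exists>g. integrable circle g \<and> equidist g \<and> (\<integral>z. norm (h z - g z) \<partial>circle) < e"
    using s by (auto simp: eventually_sequentially)
qed

lemma equidist_add:
  assumes f: "integrable circle f" "equidist f" and g: "integrable circle g" "equidist g"
  shows "equidist (\<lambda>z. f z + g z)"
  unfolding equidist_def
proof (rule tendsto_sandwich [OF _ _ tendsto_const])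
  let ?F = "\<integral>w. f w \<partial>circle" and ?G = "\<integral>w. g w \<partial>circle"
  show "(\<lambda>n. (\<integral>z. norm (root_avg n f z - ?F) \<partial>circle) + (\<integral>z. norm (root_avg n g z - ?G) \<partial>circle)) \<longlonglongrightarrow> 0"
    using tendsto_add [OF f(2) [unfolded equidist_def] g(2) [unfolded equidist_def]] by simp
  show "\<forall>\<^sub>F n in sequentially. (\<integral>z. norm (root_avg n (\<lambda>z. f z + g z) z - (\<integral>w. f w + g w \<partial>circle)) \<partial>circle)
      \<le> (\<integral>z. norm (root_avg n f z - ?F) \<partial>circle) + (\<integral>z. norm (root_avg n g z - ?G) \<partial>circle)"
    using eventually_gt_at_top [of 0]
  proof eventually_elim
    case (elim n)
    note [simp] = f(1) g(1) integrable_root_avg [OF f(1) elim] integrable_root_avg [OF g(1) elim]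
    have "(\<integral>z. norm (root_avg n (\<lambda>z. f z + g z) z - (\<integral>w. f w + g w \<partial>circle)) \<partial>circle)
        \<le> (\<integral>z. norm (root_avg n f z - ?F) + norm (root_avg n g z - ?G) \<partial>circle)"
    proof (rule integral_mono)
      fix z
      show "norm (root_avg n (\<lambda>z. f z + g z) z - (\<integral>w. f w + g w \<partial>circle)) \<le>
          norm (root_avg n f z - ?F) + norm (root_avg n g z - ?G)"
        using norm_triangle_ineq [of "root_avg n f z - ?F" "root_avg n g z - ?G"]
        by (simp add: root_avg_add algebra_simps)
    qed (simp_all add: root_avg_add)
    then show ?case
      by simp
  qed
qed auto

text \<open>A real function times a fixed vector is the shape of the base case of
  \<open>integrable_induct\<close>.\<close>

lemma equidist_scaleR:
  fixes f :: "complex \<Rightarrow> real"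
  assumes int: "integrable circle f" and f: "equidist f"
  shows "equidist (\<lambda>z. f z *\<^sub>R c)"
proof -
  have "norm (root_avg n (\<lambda>z. f z *\<^sub>R c) z - (\<integral>w. f w *\<^sub>R c \<partial>circle)) =
      norm (root_avg n f z - (\<integral>w. f w \<partial>circle)) * norm c" for n z
    by (simp add: root_avg_scaleR int flip: scaleR_diff_left)
  then show ?thesis
    using tendsto_mult_left_zero [OF f [unfolded equidist_def], of "norm c"]
    by (simp add: equidist_def)
qed

lemma equidist_const: "equidist (\<lambda>z. c)"
  unfolding equidist_def
proof (rule tendsto_eventually)
  show "\<forall>\<^sub>F n in sequentially. (\<integral>z. norm (root_avg n (\<lambda>z. c) z - (\<integral>w. c \<partial>circle)) \<partial>circle) = 0"
    using eventually_gt_at_top [of 0]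
  proof eventually_elim
    case (elim n)
    have "(\<integral>z. norm (root_avg n (\<lambda>z. c) z - (\<integral>w. c \<partial>circle)) \<partial>circle) = (\<integral>z. 0 \<partial>circle)"
      using elim by (intro Bochner_Integration.integral_cong refl) (auto intro!: root_avg_const)
    then show ?case
      by simp
  qed
qed

section \<open>From arcs to Borel sets\<close>

lemma average_indicator_lessThan:
  assumes "0 \<le> t" "t < 1" "n > 0"
  shows "\<bar>(1 / real n) * (\<Sum>j<n. indicator {..<a} ((t + real j) / real n)) - max 0 (min 1 a)\<bar> \<le> 1 / real n"
proof -
  \<comment> \<open>The number of indices \<open>j\<close> counted. \<open>nat\<close> and
    \<open>min\<close> truncate it when \<open>a\<close> lies outside [0,1]; as \<open>t\<close> is
    in [0,1), rounding up \<open>a * real n - t\<close> misses \<open>a * real n\<close> by at most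
    1.\<close>
  define k where "k = min n (nat \<lceil>a * real n - t\<rceil>)"
  have "(t + real j) / real n < a \<longleftrightarrow> j < nat \<lceil>a * real n - t\<rceil>" for j
    using \<open>n > 0\<close> by (simp add: divide_less_eq zless_nat_eq_int_zless less_ceiling_iff) linarith
  then have "(\<Sum>j<n. indicator {..<a} ((t + real j) / real n)) = (\<Sum>j<n. if j < k then 1 else (0::real))"
    by (intro sum.cong) (auto simp: indicator_def k_def)
  also have "\<dots> = real (card {j\<in>{..<n}. j < k})"
    by (simp add: sum.If_cases Int_def)
  also have "{j\<in>{..<n}. j < k} = {..<k}"
    by (auto simp: k_def)
  finally have sum: "(\<Sum>j<n. indicator {..<a} ((t + real j) / real n)) = real k"
    by simp
  have k: "real k = max 0 (min (real n) (of_int \<lceil>a * real n - t\<rceil>))"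
  proof -
    have "real (min n (nat c)) = max 0 (min (real n) (of_int c))" for c :: int
    proof -
      have "real (nat c) = max 0 (of_int c)"
        by simp
      then show ?thesis
        unfolding of_nat_min by linarith
    qed
    then show ?thesis
      unfolding k_def .
  qed
  have m: "max 0 (min 1 a) * real n = max 0 (min (real n) (a * real n))"
  proof -
    have "1 < a \<longleftrightarrow> real n < a * real n" "0 < a \<longleftrightarrow> 0 < a * real n"
      using \<open>n > 0\<close> by (simp_all add: zero_less_mult_iff)
    then show ?thesis
      by (cases "a > 1"; cases "a > 0") (auto simp: min_def max_def)
  qed
  have "\<bar>real k - max 0 (min 1 a) * real n\<bar> \<le> 1"
    using ceiling_correct [of "a * real n - t"] assms(1,2) unfolding k m by linarith
  then have "\<bar>real k - max 0 (min 1 a) * real n\<bar> / real n \<le> 1 / real n"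
    by (rule divide_right_mono) simp
  also have "\<bar>real k - max 0 (min 1 a) * real n\<bar> / real n = \<bar>(real k - max 0 (min 1 a) * real n) / real n\<bar>"
    by simp
  also have "(real k - max 0 (min 1 a) * real n) / real n = (1 / real n) * real k - max 0 (min 1 a)"
    using \<open>n > 0\<close> by (simp add: field_simps)
  finally show ?thesis
    unfolding sum .
qed

lemma turn_inj:
  assumes "turn a = turn b" "a \<in> {0..<1}" "b \<in> {0..<1}"
  shows "a = b"
proof -
  have "turn (a - b) = 1"
    using assms(1) by (simp add: right_diff_distrib flip: cis_divide)
  then have "cos (2 * pi * (a - b)) = 1"
    by (simp add: complex_eq_iff)
  then obtain k :: int where "2 * pi * (a - b) = real_of_int k * 2 * pi"
    by (auto simp: cos_one_2pi_int)
  then have k: "a - b = real_of_int k"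
    by simp
  then have "\<bar>real_of_int k\<bar> < 1"
    using assms(2,3) by auto
  then have "k = 0"
    by (metis of_int_abs of_int_less_1_iff zabs_less_one_iff)
  then show ?thesis
    using k by simp
qed

text \<open>Passing to the fractional part makes the angle unique, so the angles of the roots of a
  point can be identified by \<open>turn_inj\<close>.\<close>

lemma turn_section_unit:
  obtains s where "s \<in> borel_measurable circle"
    "\<And>z. cmod z = 1 \<Longrightarrow> turn (s z) = z" "\<And>z. s z \<in> {0..<1}"
proof -
  obtain s where s: "s \<in> borel_measurable borel" "\<And>z. cmod z = 1 \<Longrightarrow> turn (s z) = z"
    using turn_section by blast
  have [measurable]: "s \<in> borel_measurable circle"
    using s(1) unfolding measurable_cong_sets [OF sets_circle refl] by (rule measurable_restrict_space1)
  have turn_frac: "turn (frac x) = turn x" for x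
    by (simp add: frac_def right_diff_distrib flip: cis_divide)
  show thesis
  proof
    show "(\<lambda>z. frac (s z)) \<in> borel_measurable circle"
      unfolding frac_def by measurable
  qed (auto simp: turn_frac s(2) frac_lt_1)
qed

lemma root_avg_cong:
  assumes "\<And>z. cmod z = 1 \<Longrightarrow> f z = g z" "cmod z = 1"
  shows "root_avg n f z = root_avg n g z"
proof (cases "n = 0")
  case False
  then have "(\<Sum>w | w ^ n = z. f w) = (\<Sum>w | w ^ n = z. g w)"
    using assms by (intro sum.cong) (auto intro: root_norm_1)
  then show ?thesis
    by (simp add: root_avg_def)
qed (simp add: root_avg_def)

lemma equidist_cong:
  assumes "\<And>z. cmod z = 1 \<Longrightarrow> f z = g z"
  shows "equidist f \<longleftrightarrow> equidist g"
proof -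
  have "(\<integral>w. f w \<partial>circle) = (\<integral>w. g w \<partial>circle)"
    using assms by (intro Bochner_Integration.integral_cong) auto
  then have "(\<integral>z. norm (root_avg n f z - (\<integral>w. f w \<partial>circle)) \<partial>circle) =
      (\<integral>z. norm (root_avg n g z - (\<integral>w. g w \<partial>circle)) \<partial>circle)" for n
    using root_avg_cong [of f g, OF assms] by (intro Bochner_Integration.integral_cong) auto
  then show ?thesis
    by (simp add: equidist_def)
qed

text \<open>Sets on the circle are described by Borel sets of angles. The half-lines generate these
  and are closed under intersection, so a Dynkin argument extends the counting estimate from arcs to
  all of them.\<close>

lemma equidist_indicator:
  assumes A: "A \<in> sets circle"
  shows "equidist (indicator A :: complex \<Rightarrow> real)"
proof -
  obtain s where [measurable]: "s \<in> borel_measurable circle"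
    and turn_s: "\<And>z. cmod z = 1 \<Longrightarrow> turn (s z) = z" and s_unit: "\<And>z. s z \<in> {0..<1}"
    using turn_section_unit by blast
  have int: "integrable circle (\<lambda>z. indicator B (s z) :: real)" if "B \<in> sets borel" for B
  proof (rule finite_measure.integrable_const_bound [OF finite_measure_circle])
    show "(\<lambda>z. indicator B (s z) :: real) \<in> borel_measurable circle"
      using that by measurable
  qed (auto intro: AE_I2 simp: indicator_def)
  have "equidist (\<lambda>z. indicator B (s z) :: real)" if "B \<in> sets borel" for B
  proof -
    have "{..<a} \<inter> {..<b} = {..<min a b}" for a b :: real
      by auto
    then have "Int_stable (range lessThan :: real set set)" "range lessThan \<subseteq> Pow (UNIV :: real set)"
      by (auto simp: Int_stable_def)
    moreover have "B \<in> sigma_sets UNIV (range lessThan)"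
      using that by (simp add: borel_Iio)
    ultimately show ?thesis
    proof (induction rule: sigma_sets_induct_disjoint)
      case (basic B)
      then obtain a where B: "B = {..<a}"
        by auto
      define h where "h z = (indicator B (s z) :: real)" for z
      define c where "c = max 0 (min 1 a)"
      have h: "integrable circle h"
        unfolding h_def by (rule int) (simp add: B)
      have avg: "\<bar>root_avg n h z - c\<bar> \<le> 1 / real n" if "cmod z = 1" "n > 0" for n z
      proof -
        obtain t where t: "z = turn t" "0 \<le> t" "t < 1"
          using turn_s [OF \<open>cmod z = 1\<close>] s_unit [of z] by (auto dest: sym)
        have "s (turn ((t + real j) / real n)) = (t + real j) / real n" if "j < n" for j
        proof (rule turn_inj)
          have "t + real j < real n"
            using t that by linarith
          then show "(t + real j) / real n \<in> {0..<1}"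
            using t that by auto
        qed (use s_unit turn_s in auto)
        then have "root_avg n h z = (1 / real n) * (\<Sum>j<n. indicator {..<a} ((t + real j) / real n))"
          using \<open>n > 0\<close> by (simp add: root_avg_def t(1) sum_roots_turn h_def B)
        then show ?thesis
          using average_indicator_lessThan [OF t(2,3) \<open>n > 0\<close>] by (simp only: c_def)
      qed
      \<comment> \<open>The mean of \<open>h\<close> is not computed: averaging preserves it, so it
        inherits the bound from the averages. The two errors of 1/n add up to the 2/n below.\<close>
      have int_h: "\<bar>(\<integral>z. h z \<partial>circle) - c\<bar> \<le> 1 / real n" if "n > 0" for n
      proof -
        note [simp] = integrable_root_avg [OF h that]
        have "(\<integral>z. h z \<partial>circle) - c = (\<integral>z. root_avg n h z - c \<partial>circle)"
          by (simp add: integral_root_avg [OF h that])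
        also have "\<bar>\<dots>\<bar> \<le> (\<integral>z. \<bar>root_avg n h z - c\<bar> \<partial>circle)"
          by (rule integral_abs_bound)
        also have "\<dots> \<le> (\<integral>z. 1 / real n \<partial>circle)"
          by (rule integral_mono) (use avg that in auto)
        finally show ?thesis
          by simp
      qed
      have "equidist h"
        unfolding equidist_def
      proof (rule tendsto_sandwich [OF _ _ tendsto_const])
        show "\<forall>\<^sub>F n in sequentially.
            (\<integral>z. norm (root_avg n h z - (\<integral>w. h w \<partial>circle)) \<partial>circle) \<le> 2 / real n"
          using eventually_gt_at_top [of 0]
        proof eventually_elim
          case (elim n)
          note [simp] = integrable_root_avg [OF h elim]
          have "(\<integral>z. norm (root_avg n h z - (\<integral>w. h w \<partial>circle)) \<partial>circle) \<le> (\<integral>z. 2 / real n \<partial>circle)"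
          proof (rule integral_mono)
            fix z
            assume "z \<in> space circle"
            then have "\<bar>root_avg n h z - c\<bar> \<le> 1 / real n"
              using avg elim by simp
            moreover have "2 / real n = 1 / real n + 1 / real n"
              by simp
            ultimately show "norm (root_avg n h z - (\<integral>w. h w \<partial>circle)) \<le> 2 / real n"
              using int_h [OF elim] unfolding real_norm_def by linarith
          qed simp_all
          then show ?case
            by simp
        qed
        show "(\<lambda>n. 2 / real n) \<longlonglongrightarrow> 0"
          by (rule lim_const_over_n)
      qed auto
      then show ?case
        by (simp add: h_def [abs_def])
    next
      case empty
      show ?case
        using equidist_const [of "0::real"] by simp
    next
      case (compl B)
      have "equidist (\<lambda>z. 1 + indicator B (s z) *\<^sub>R (-1::real))"
        using compl int by (intro equidist_add equidist_scaleR equidist_const) (auto simp: borel_Iio)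
      moreover have "indicator (UNIV - B) x = 1 + indicator B x *\<^sub>R (-1::real)" for x
        by (auto simp: indicator_def)
      ultimately show ?case
        by simp
    next
      case (union B)
      have B: "B i \<in> sets borel" for i
        using union by (auto simp: borel_Iio)
      \<comment> \<open>Disjointness makes the indicator of a finite union a sum, so additivity
        applies; the countable union is then a dominated limit.\<close>
      have fin: "equidist (\<lambda>z. indicator (\<Union>i<n. B i) (s z) :: real)" for n
      proof (induction n)
        case 0
        show ?case
          using equidist_const [of "0::real"] by simp
      next
        case (Suc n)
        have "equidist (\<lambda>z. indicator (\<Union>i<n. B i) (s z) + indicator (B n) (s z) :: real)"
          using Suc union B by (intro equidist_add int) auto
        moreover have "indicator (\<Union>i<n. B i) x + indicator (B n) x = (indicator (\<Union>i<Suc n. B i) x :: real)" for x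
        proof -
          have "B i \<inter> B n = {}" if "i < n" for i
            using disjoint_family_onD [OF \<open>disjoint_family B\<close>, of i n] that by simp
          then have "(\<Union>i<n. B i) \<inter> B n = {}"
            by blast
          then have "indicator ((\<Union>i<n. B i) \<union> B n) x = (indicator (\<Union>i<n. B i) x + indicator (B n) x :: real)"
            by (simp add: indicator_add)
          moreover have "(\<Union>i<Suc n. B i) = (\<Union>i<n. B i) \<union> B n"
            by (auto simp: lessThan_Suc)
          ultimately show ?thesis
            by simp
        qed
        ultimately show ?case
          by simp
      qed
      show ?case
      proof (rule equidist_lim [where s = "\<lambda>n z. indicator (\<Union>i<n. B i) (s z)"])
        show "(\<lambda>n. indicator (\<Union>i<n. B i) (s z) :: real) \<longlonglongrightarrow> indicator (\<Union>i. B i) (s z)" for z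
          by (rule LIMSEQ_indicator_UN)
        show "integrable circle (\<lambda>z. indicator (\<Union>i. B i) (s z) :: real)"
          "integrable circle (\<lambda>z. indicator (\<Union>i<n. B i) (s z) :: real)" for n
          by (rule int; use B in auto)+
      qed (use fin in \<open>auto simp: indicator_def\<close>)
    qed
  qed
  moreover have "turn -` A \<in> sets borel"
    using measurable_sets [OF measurable_turn A] by simp
  ultimately have "equidist (\<lambda>z. indicator (turn -` A) (s z) :: real)"
    by blast
  then show ?thesis
    by (rule equidist_cong [THEN iffD1, rotated]) (simp add: indicator_def turn_s)
qed

theorem equidist:
  fixes h :: "complex \<Rightarrow> 'a::{banach, second_countable_topology}"
  assumes "integrable circle h"
  shows "equidist h"
  using assms
proof (induction rule: integrable_induct)
  case (base A c)
  then show ?case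
    by (intro equidist_scaleR equidist_indicator integrable_real_indicator)
next
  case (add f g)
  then show ?case
    by (intro equidist_add)
next
  case (lim f s)
  then show ?case
    by (intro equidist_lim [of f s])
qed

section \<open>The Wold decomposition of an isometry with an adjoint\<close>

text \<open>The adjoint is a parameter, since existence is not automatic in an inner product space
  that may be incomplete. A real inner product suffices: norms, limits and ranges are the same as
  for the complex one.\<close>

locale adjoint_isometry =
  fixes S A :: "'a::real_inner \<Rightarrow> 'a"
  assumes lin: "linear S"
    and iso: "norm (S f) = norm f"
    and adj: "S f \<bullet> g = f \<bullet> A g"
begin

text \<open>Polarization: \<open>dot_norm\<close> expresses the inner product through norms
  alone.\<close>

lemma inner_S: "S f \<bullet> S g = f \<bullet> g"
proof -
  have "norm (S f + S g) = norm (f + g)"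
    using iso [of "f + g"] by (simp only: linear_add [OF lin])
  then show ?thesis
    unfolding dot_norm [of "S f"] dot_norm [of f] iso by (rule arg_cong)
qed

lemma A_S: "A (S f) = f"
proof -
  have "g \<bullet> A (S f) = g \<bullet> f" for g
    using adj [of g "S f"] inner_S [of g f] by simp
  then show ?thesis
    using vector_eq_ldot by blast
qed

lemma linear_A: "linear A"
proof (rule linearI)
  show "A (x + y) = A x + A y" for x y
  proof -
    have "z \<bullet> A (x + y) = z \<bullet> (A x + A y)" for z
      using adj [of z "x + y"] adj [of z x] adj [of z y] by (simp add: inner_add_right)
    then show ?thesis
      using vector_eq_ldot by blast
  qed
  show "A (r *\<^sub>R x) = r *\<^sub>R A x" for r x
  proof -
    have "z \<bullet> A (r *\<^sub>R x) = z \<bullet> (r *\<^sub>R A x)" for z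
      using adj [of z "r *\<^sub>R x"] adj [of z x] by simp
    then show ?thesis
      using vector_eq_ldot by blast
  qed
qed

lemma norm_A_le: "norm (A f) \<le> norm f"
proof (cases "A f = 0")
  case False
  have "norm (A f) * norm (A f) = S (A f) \<bullet> f"
    using adj [of "A f" f] by (simp add: power2_norm_eq_inner flip: power2_eq_square)
  also have "\<dots> \<le> norm (A f) * norm f"
    using norm_cauchy_schwarz [of "S (A f)" f] by (simp add: iso)
  finally show ?thesis
    using False by simp
qed simp

text \<open>Powers stay inside the locale, so each fact about \<open>S\<close> and \<open>A\<close>
  is also one about \<open>S ^^ k\<close> and \<open>A ^^ k\<close>.\<close>

lemma funpow_adjoint_isometry: "adjoint_isometry (S ^^ k) (A ^^ k)"
proof (induction k)
  case 0
  show ?case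
    by (rule adjoint_isometry.intro) (simp_all add: linear_iff)
next
  case (Suc k)
  then interpret k: adjoint_isometry "S ^^ k" "A ^^ k" .
  show ?case
  proof (rule adjoint_isometry.intro)
    show "linear (S ^^ Suc k)"
      using linear_compose [OF k.lin lin] by simp
    show "norm ((S ^^ Suc k) f) = norm f" for f
      by (simp add: iso k.iso)
    show "(S ^^ Suc k) f \<bullet> g = f \<bullet> (A ^^ Suc k) g" for f g
      by (simp add: adj k.adj funpow_swap1)
  qed
qed

lemma A_S_funpow: "(A ^^ k) ((S ^^ k) f) = f"
  by (rule adjoint_isometry.A_S [OF funpow_adjoint_isometry])

definition range_proj :: "nat \<Rightarrow> 'a \<Rightarrow> 'a" where
  "range_proj k f = (S ^^ k) ((A ^^ k) f)"

lemma range_proj_S: "range_proj k ((S ^^ k) f) = (S ^^ k) f"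
  by (simp add: range_proj_def A_S_funpow)

text \<open>The ranges of the powers decrease, and each projection is the identity on its own
  range.\<close>

lemma range_proj_range_proj:
  assumes "j \<le> k"
  shows "range_proj j (range_proj k f) = range_proj k f"
proof -
  have "S ^^ k = S ^^ j \<circ> S ^^ (k - j)"
    using assms by (simp flip: funpow_add)
  then have "range_proj k f = (S ^^ j) ((S ^^ (k - j)) ((A ^^ k) f))"
    by (simp add: range_proj_def)
  then show ?thesis
    by (simp add: range_proj_S)
qed

lemma linear_range_proj: "linear (range_proj k)"
  using linear_compose [OF adjoint_isometry.linear_A adjoint_isometry.lin,
      OF funpow_adjoint_isometry funpow_adjoint_isometry, of k k]
  by (simp add: range_proj_def [abs_def] o_def)

lemma norm_range_proj_le: "norm (range_proj k f) \<le> norm f"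
  using adjoint_isometry.norm_A_le [OF funpow_adjoint_isometry]
    adjoint_isometry.iso [OF funpow_adjoint_isometry]
  by (simp add: range_proj_def)

lemma range_proj_symmetric: "range_proj k f \<bullet> g = f \<bullet> range_proj k g"
  using adjoint_isometry.adj [OF funpow_adjoint_isometry, of k "(A ^^ k) f" g]
    adjoint_isometry.adj [OF funpow_adjoint_isometry, of k "(A ^^ k) g" f]
  by (simp add: range_proj_def inner_commute)

text \<open>Pythagoras for nested projections: the difference is orthogonal to
  \<open>range_proj k f\<close>.\<close>

lemma norm_range_proj_diff:
  assumes "j \<le> k"
  shows "(norm (range_proj j f - range_proj k f))\<^sup>2 = (norm (range_proj j f))\<^sup>2 - (norm (range_proj k f))\<^sup>2"
proof -
  have "range_proj j f \<bullet> range_proj k f = f \<bullet> range_proj k f"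
    by (simp add: range_proj_symmetric range_proj_range_proj assms)
  moreover have "f \<bullet> range_proj k f = range_proj k f \<bullet> range_proj k f"
    using range_proj_symmetric [of k "range_proj k f" f]
    by (simp add: range_proj_range_proj inner_commute)
  ultimately show ?thesis
    by (simp add: power2_norm_eq_inner inner_diff_left inner_diff_right inner_commute)
qed

text \<open>The squared norms decrease and are nonnegative, hence converge; by Pythagoras their
  differences are the squared distances, so the tolerance for them is the square of
  \<open>e\<close>.\<close>

lemma Cauchy_range_proj: "Cauchy (\<lambda>k. range_proj k f)"
proof (rule metric_CauchyI)
  fix e :: real
  assume "e > 0"
  let ?a = "\<lambda>k. (norm (range_proj k f))\<^sup>2"
  have "decseq ?a"
  proof (rule decseq_SucI)
    fix k
    show "?a (Suc k) \<le> ?a k"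
      using norm_range_proj_diff [of k "Suc k" f] zero_le_power2 [of "norm (range_proj k f - range_proj (Suc k) f)"]
      by simp
  qed
  then obtain L where "?a \<longlonglongrightarrow> L"
    by (rule decseq_convergent [where B = 0]) auto
  then have "Cauchy ?a"
    by (rule LIMSEQ_imp_Cauchy)
  then obtain M where M: "\<And>j k. j \<ge> M \<Longrightarrow> k \<ge> M \<Longrightarrow> \<bar>?a j - ?a k\<bar> < e\<^sup>2"
    using CauchyD [of ?a "e\<^sup>2"] \<open>e > 0\<close> by auto
  have less: "dist (range_proj j f) (range_proj k f) < e" if "j \<ge> M" "j \<le> k" for j k
  proof -
    have "(norm (range_proj j f - range_proj k f))\<^sup>2 < e\<^sup>2"
      using norm_range_proj_diff [of j k f] M [of j k] that by simp
    then show ?thesis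
      using \<open>e > 0\<close> by (simp add: dist_norm power_less_imp_less_base)
  qed
  have "dist (range_proj j f) (range_proj k f) < e" if "j \<ge> M" "k \<ge> M" for j k
    using less [of j k] less [of k j] that by (cases "j \<le> k") (auto simp: dist_commute)
  then show "\<exists>M. \<forall>m\<ge>M. \<forall>n\<ge>M. dist (range_proj m f) (range_proj n f) < e"
    by blast
qed

text \<open>Completeness ensures that \<open>lim\<close> denotes an actual limit. Each
  \<open>range_proj j\<close> is continuous and eventually fixes the terms of the sequence, so it
  fixes the limit; conversely a vector in every range gives a constant sequence.\<close>

lemma range_lim_range_proj:
  assumes complete: "\<And>X :: nat \<Rightarrow> 'a. Cauchy X \<Longrightarrow> convergent X"
  shows "range (\<lambda>f. lim (\<lambda>k. range_proj k f)) = (\<Inter>k. range (S ^^ k))"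
proof (intro equalityI subsetI)
  fix g
  assume "g \<in> range (\<lambda>f. lim (\<lambda>k. range_proj k f))"
  then obtain f where g: "g = lim (\<lambda>k. range_proj k f)"
    by auto
  have lim: "(\<lambda>k. range_proj k f) \<longlonglongrightarrow> g"
    unfolding g using complete [OF Cauchy_range_proj] by (simp add: convergent_LIMSEQ_iff)
  have "g \<in> range (S ^^ j)" for j
  proof -
    have "bounded_linear (range_proj j)"
      by (rule bounded_linear_intro [where K = 1])
         (simp_all add: linear_add linear_scale linear_range_proj norm_range_proj_le)
    then have "(\<lambda>k. range_proj j (range_proj k f)) \<longlonglongrightarrow> range_proj j g"
      using lim by (rule bounded_linear.tendsto)
    moreover have "\<forall>\<^sub>F k in sequentially. range_proj j (range_proj k f) = range_proj k f"
      using eventually_ge_at_top [of j] by eventually_elim (rule range_proj_range_proj)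
    ultimately have "(\<lambda>k. range_proj k f) \<longlonglongrightarrow> range_proj j g"
      by (simp cong: tendsto_cong)
    then have "g = range_proj j g"
      using lim by (intro LIMSEQ_unique)
    then show ?thesis
      unfolding range_proj_def by (rule range_eqI)
  qed
  then show "g \<in> (\<Inter>k. range (S ^^ k))"
    by blast
next
  fix g
  assume "g \<in> (\<Inter>k. range (S ^^ k))"
  then have "range_proj k g = g" for k
    by (metis INT_E UNIV_I rangeE range_proj_S)
  then have "lim (\<lambda>k. range_proj k g) = g"
    by simp
  then show "g \<in> range (\<lambda>f. lim (\<lambda>k. range_proj k f))"
    by (intro range_eqI) (rule sym)
qed

end

section \<open>The Hilbert space $L^2$ of the circle\<close>

lemma square_integrable_rep: "square_integrable (rep_l2_circle x)"
  using Quotient_rep_reflp [OF Quotient_l2_circle, of x] by (simp add: l2_eq_def)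

lemma abs_rep_l2_circle [simp]: "abs_l2_circle (rep_l2_circle x) = x"
  by (rule Quotient_abs_rep [OF Quotient_l2_circle])

lemma l2_eq_refl: "square_integrable f \<Longrightarrow> l2_eq f f"
  by (simp add: l2_eq_def)

lemma abs_l2_circle_eq_iff:
  assumes "square_integrable f" "square_integrable g"
  shows "abs_l2_circle f = abs_l2_circle g \<longleftrightarrow> (AE z in circle. f z = g z)"
  using Quotient_rel [OF Quotient_l2_circle, of f g] assms by (auto simp: l2_eq_def)

text \<open>Representatives are arbitrary choices, so algebraic identities hold for them only almost
  everywhere. This is the bridge used for all of them.\<close>

lemma AE_rep_abs:
  assumes "square_integrable f"
  shows "AE z in circle. rep_l2_circle (abs_l2_circle f) z = f z"
  using abs_l2_circle_eq_iff [OF square_integrable_rep assms, of "abs_l2_circle f"] by simp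

lemma measurable_rep [measurable]: "rep_l2_circle x \<in> borel_measurable circle"
  using square_integrable_rep by (simp add: square_integrable_def)

lemma AE_rep_scaleC: "AE z in circle. rep_l2_circle (c *\<^sub>C x) z = c * rep_l2_circle x z"
proof -
  have "c *\<^sub>C x = abs_l2_circle (\<lambda>z. c * rep_l2_circle x z)"
    using scaleC.abs_eq [OF l2_eq_refl [OF square_integrable_rep], of c x] by simp
  then show ?thesis
    using AE_rep_abs [OF square_integrable_scale [OF square_integrable_rep]] by simp
qed

lemma AE_rep_add: "AE z in circle. rep_l2_circle (x + y) z = rep_l2_circle x z + rep_l2_circle y z"
proof -
  have "x + y = abs_l2_circle (\<lambda>z. rep_l2_circle x z + rep_l2_circle y z)"
    using plus_l2_circle.abs_eq [OF l2_eq_refl l2_eq_refl, OF square_integrable_rep square_integrable_rep, of x y]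
    by simp
  then show ?thesis
    using AE_rep_abs [OF square_integrable_add [OF square_integrable_rep square_integrable_rep]] by simp
qed

lemma AE_rep_diff: "AE z in circle. rep_l2_circle (x - y) z = rep_l2_circle x z - rep_l2_circle y z"
proof -
  have eq: "x - y = x + (-1) *\<^sub>C y"
    by (simp only: minus_l2_circle_def uminus_l2_circle_def)
  show ?thesis
    using AE_rep_add [of x "(-1) *\<^sub>C y"] AE_rep_scaleC [of "-1" y]
    unfolding eq by eventually_elim simp
qed

lemma cinner_eq: "cinner x y = (\<integral>z. rep_l2_circle x z * cnj (rep_l2_circle y z) \<partial>circle)"
  using cinner.abs_eq [OF l2_eq_refl l2_eq_refl, OF square_integrable_rep square_integrable_rep, of x y]
  by simp

lemma cinner_add_left: "cinner (x + y) z = cinner x z + cinner y z"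
  by transfer (simp add: l2_eq_def distrib_right integrable_mult_cnj)

lemma cinner_scaleC_left: "cinner (c *\<^sub>C x) y = c * cinner x y"
  by transfer (simp add: mult.assoc)

lemma cinner_commute: "cinner y x = cnj (cinner x y)"
proof -
  have "cnj (cinner x y) = (\<integral>z. cnj (rep_l2_circle x z * cnj (rep_l2_circle y z)) \<partial>circle)"
    unfolding cinner_eq by (rule Bochner_Integration.integral_cnj [symmetric])
  then show ?thesis
    by (simp add: cinner_eq mult.commute)
qed

lemma integrable_rep_square: "integrable circle (\<lambda>z. (cmod (rep_l2_circle x z))\<^sup>2)"
  using square_integrable_rep by (simp add: square_integrable_def)

lemma cinner_self_integral:
  "cinner x x = complex_of_real (\<integral>z. (cmod (rep_l2_circle x z))\<^sup>2 \<partial>circle)"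
proof -
  have "cinner x x = (\<integral>z. complex_of_real ((cmod (rep_l2_circle x z))\<^sup>2) \<partial>circle)"
    by (simp only: cinner_eq complex_norm_square)
  also have "\<dots> = complex_of_real (\<integral>z. (cmod (rep_l2_circle x z))\<^sup>2 \<partial>circle)"
    by (rule integral_of_real [OF integrable_rep_square])
  finally show ?thesis .
qed

lemma power2_norm_l2: "(norm x)\<^sup>2 = (\<integral>z. (cmod (rep_l2_circle x z))\<^sup>2 \<partial>circle)"
  by (simp only: power2_norm_eq_inner [of x] inner_l2_circle_def cinner_self_integral Re_complex_of_real)

lemma cinner_self: "cinner x x = complex_of_real ((norm x)\<^sup>2)"
  by (simp only: cinner_self_integral power2_norm_l2)

lemma l2_eqI:
  assumes "AE z in circle. rep_l2_circle x z = rep_l2_circle y z"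
  shows "x = y"
  using abs_l2_circle_eq_iff [OF square_integrable_rep square_integrable_rep, of x y] assms by simp

text \<open>The type class yields this only for real scalars; the complex case is read off from
  \<open>cinner\<close>.\<close>

lemma norm_scaleC: "norm (c *\<^sub>C x) = cmod c * norm x"
proof -
  have "cinner (c *\<^sub>C x) (c *\<^sub>C x) = c * cnj (c * cinner x x)"
    by (simp add: cinner_scaleC_left cinner_commute [of x "c *\<^sub>C x"])
  also have "\<dots> = (c * cnj c) * complex_of_real ((norm x)\<^sup>2)"
    by (simp add: cinner_self)
  also have "\<dots> = complex_of_real ((cmod c * norm x)\<^sup>2)"
    by (simp only: power_mult_distrib of_real_mult complex_norm_square)
  finally have "(norm (c *\<^sub>C x))\<^sup>2 = (cmod c * norm x)\<^sup>2"
    by (simp only: cinner_self of_real_eq_iff)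
  then show ?thesis
    by (simp add: power2_eq_iff_nonneg)
qed

section \<open>Completeness of L2\<close>

lemma integrable_rep: "integrable circle (rep_l2_circle x)"
  using integrable_mult_cnj [OF square_integrable_rep, of "\<lambda>_. 1" x] by (simp add: square_integrable_def)

text \<open>On a probability space the L1 norm is at most the L2 norm. The strict bound comes from
  integrating 2 e |f| \<le> |f|^2 + e^2, and turns an L2 Cauchy sequence into an L1 one.\<close>

lemma L1_norm_rep_le:
  assumes "norm x < e"
  shows "(\<integral>z. cmod (rep_l2_circle x z) \<partial>circle) < e"
proof -
  let ?f = "rep_l2_circle x"
  have "e > 0"
    using assms norm_ge_zero [of x] by linarith
  have int: "integrable circle (\<lambda>z. (cmod (?f z))\<^sup>2)"
    using square_integrable_rep by (simp add: square_integrable_def)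
  have "(\<integral>z. 2 * e * cmod (?f z) \<partial>circle) \<le> (\<integral>z. (cmod (?f z))\<^sup>2 + e\<^sup>2 \<partial>circle)"
  proof (rule integral_mono)
    show "2 * e * cmod (?f z) \<le> (cmod (?f z))\<^sup>2 + e\<^sup>2" for z
      using sum_squares_bound [of e "cmod (?f z)"] by simp
  qed (use int integrable_rep in auto)
  also have "\<dots> = (norm x)\<^sup>2 + e\<^sup>2"
    using int by (simp add: power2_norm_l2)
  also have "\<dots> < e\<^sup>2 + e\<^sup>2"
    using assms by (simp add: power_strict_mono)
  finally have "2 * e * (\<integral>z. cmod (?f z) \<partial>circle) < 2 * e * e"
    by (simp add: power2_eq_square)
  then show ?thesis
    using \<open>e > 0\<close> by simp
qed

text \<open>Riesz-Fischer: an L1 Cauchy sequence has an almost everywhere convergent subsequence,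
  and Fatou upgrades its limit to an L2 limit of the whole sequence.\<close>

lemma l2_circle_complete:
  fixes X :: "nat \<Rightarrow> l2_circle"
  assumes "Cauchy X"
  shows "convergent X"
proof -
  let ?f = "\<lambda>n. rep_l2_circle (X n)"
  have "\<exists>M. \<forall>i\<ge>M. \<forall>j\<ge>M. (\<integral>z. norm (?f i z - ?f j z) \<partial>circle) < e" if e: "e > 0" for e
  proof -
    obtain M where M: "\<And>i j. i \<ge> M \<Longrightarrow> j \<ge> M \<Longrightarrow> norm (X i - X j) < e"
      using CauchyD [OF assms e] by blast
    have "(\<integral>z. norm (?f i z - ?f j z) \<partial>circle) < e" if "i \<ge> M" "j \<ge> M" for i j
    proof -
      have "(\<integral>z. norm (?f i z - ?f j z) \<partial>circle) = (\<integral>z. cmod (rep_l2_circle (X i - X j) z) \<partial>circle)"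
        by (intro integral_cong_AE) (use AE_rep_diff [of "X i" "X j"] in \<open>auto elim: eventually_mono\<close>)
      then show ?thesis
        using L1_norm_rep_le [OF M [OF that]] by simp
    qed
    then show ?thesis
      by blast
  qed
  then obtain r where r: "strict_mono r" "AE z in circle. Cauchy (\<lambda>i. ?f (r i) z)"
    using cauchy_L1_AE_cauchy_subseq [of circle ?f] integrable_rep by blast
  define g where "g z = lim (\<lambda>i. ?f (r i) z)" for z
  have [measurable]: "g \<in> borel_measurable circle"
    unfolding g_def by (rule borel_measurable_lim_metric) measurable
  have g: "AE z in circle. (\<lambda>i. ?f (r i) z) \<longlonglongrightarrow> g z"
    using r(2)
    by eventually_elim
       (auto simp: g_def intro!: convergent_LIMSEQ_iff [THEN iffD1] Cauchy_convergent)
  \<comment> \<open>With \<open>n\<close> fixed, the Cauchy bound passes along the subsequence to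
    the distance from \<open>g\<close>. Extended nonnegative integrals are used because
    \<open>g\<close> is not yet known to lie in L2.\<close>
  have fatou: "(\<integral>\<^sup>+z. ennreal ((cmod (g z - ?f n z))\<^sup>2) \<partial>circle) \<le> ennreal (e\<^sup>2)"
    if bd: "\<And>j. j \<ge> n \<Longrightarrow> norm (X j - X n) \<le> e" and "e > 0" for n e
  proof -
    have lim: "AE z in circle. ennreal ((cmod (g z - ?f n z))\<^sup>2) =
        liminf (\<lambda>i. ennreal ((cmod (?f (r i) z - ?f n z))\<^sup>2))"
      using g
    proof eventually_elim
      case (elim z)
      have "(\<lambda>i. ennreal ((cmod (?f (r i) z - ?f n z))\<^sup>2)) \<longlonglongrightarrow> ennreal ((cmod (g z - ?f n z))\<^sup>2)"
        by (intro tendsto_ennrealI tendsto_intros elim)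
      then show ?case
        by (intro lim_imp_Liminf [symmetric]) simp
    qed
    have "(\<integral>\<^sup>+z. ennreal ((cmod (g z - ?f n z))\<^sup>2) \<partial>circle) =
        (\<integral>\<^sup>+z. liminf (\<lambda>i. ennreal ((cmod (?f (r i) z - ?f n z))\<^sup>2)) \<partial>circle)"
      by (rule nn_integral_cong_AE [OF lim])
    also have "\<dots> \<le> liminf (\<lambda>i. \<integral>\<^sup>+z. ennreal ((cmod (?f (r i) z - ?f n z))\<^sup>2) \<partial>circle)"
      by (rule nn_integral_liminf) measurable
    also have "\<dots> \<le> ennreal (e\<^sup>2)"
    proof (rule order_trans [OF Liminf_mono Liminf_const [THEN eq_refl]])
      show "\<forall>\<^sub>F i in sequentially. (\<integral>\<^sup>+z. ennreal ((cmod (?f (r i) z - ?f n z))\<^sup>2) \<partial>circle) \<le> ennreal (e\<^sup>2)"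
        using eventually_ge_at_top [of n]
      proof eventually_elim
        case (elim i)
        have "r i \<ge> n"
          using seq_suble [OF r(1), of i] elim by simp
        have "(\<integral>\<^sup>+z. ennreal ((cmod (?f (r i) z - ?f n z))\<^sup>2) \<partial>circle) =
            (\<integral>\<^sup>+z. ennreal ((cmod (rep_l2_circle (X (r i) - X n) z))\<^sup>2) \<partial>circle)"
          by (intro nn_integral_cong_AE)
             (use AE_rep_diff [of "X (r i)" "X n"] in \<open>auto elim: eventually_mono\<close>)
        also have "\<dots> = ennreal ((norm (X (r i) - X n))\<^sup>2)"
          unfolding power2_norm_l2
          by (rule nn_integral_eq_integral)
             (use square_integrable_rep in \<open>auto simp: square_integrable_def\<close>)
        also have "\<dots> \<le> ennreal (e\<^sup>2)"
          using bd [OF \<open>r i \<ge> n\<close>] by (intro ennreal_leI power_mono) auto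
        finally show ?case .
      qed
    qed simp
    finally show ?thesis .
  qed
  have cauchy: "\<exists>n. \<forall>j\<ge>n. \<forall>k\<ge>n. norm (X j - X k) \<le> e" if "e > 0" for e
    using CauchyD [OF assms that] by (auto intro: less_imp_le)
  have sq: "square_integrable (\<lambda>z. g z - ?f n z)" if "\<And>j. j \<ge> n \<Longrightarrow> norm (X j - X n) \<le> 1" for n
  proof -
    have "(\<integral>\<^sup>+z. ennreal (norm ((cmod (g z - ?f n z))\<^sup>2)) \<partial>circle) =
        (\<integral>\<^sup>+z. ennreal ((cmod (g z - ?f n z))\<^sup>2) \<partial>circle)"
      by simp
    also have "\<dots> \<le> ennreal (1\<^sup>2)"
      by (rule fatou [where e = 1, OF that zero_less_one])
    also have "\<dots> < \<infinity>"
      by simp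
    finally show ?thesis
      unfolding square_integrable_def by (intro conjI integrableI_bounded) simp_all
  qed
  obtain n0 where "\<forall>j\<ge>n0. \<forall>k\<ge>n0. norm (X j - X k) \<le> 1"
    using cauchy [of 1] by auto
  then have "square_integrable (\<lambda>z. (g z - ?f n0 z) + ?f n0 z)"
    by (intro square_integrable_add sq square_integrable_rep) auto
  then have sq_g: "square_integrable g"
    by simp
  let ?g = "abs_l2_circle g"
  have "X \<longlonglongrightarrow> ?g"
  proof (rule LIMSEQ_I)
    fix e :: real
    assume "e > 0"
    \<comment> \<open>Fatou preserves only a weak inequality; half of \<open>e\<close> makes the
      final one strict.\<close>
    then obtain M where M: "\<forall>j\<ge>M. \<forall>k\<ge>M. norm (X j - X k) \<le> e / 2"
      using cauchy [of "e / 2"] by auto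
    have "norm (X n - ?g) < e" if "n \<ge> M" for n
    proof -
      have "ennreal ((norm (?g - X n))\<^sup>2) = (\<integral>\<^sup>+z. ennreal ((cmod (rep_l2_circle (?g - X n) z))\<^sup>2) \<partial>circle)"
        unfolding power2_norm_l2
        by (rule nn_integral_eq_integral [symmetric])
           (use square_integrable_rep in \<open>auto simp: square_integrable_def\<close>)
      also have "\<dots> = (\<integral>\<^sup>+z. ennreal ((cmod (g z - ?f n z))\<^sup>2) \<partial>circle)"
      proof (rule nn_integral_cong_AE)
        show "AE z in circle. ennreal ((cmod (rep_l2_circle (?g - X n) z))\<^sup>2) = ennreal ((cmod (g z - ?f n z))\<^sup>2)"
          using AE_rep_diff [of ?g "X n"] AE_rep_abs [OF sq_g] by eventually_elim simp
      qed
      also have "\<dots> \<le> ennreal ((e / 2)\<^sup>2)"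
        using M that \<open>e > 0\<close> by (intro fatou) auto
      finally have "(norm (?g - X n))\<^sup>2 \<le> (e / 2)\<^sup>2"
        by (simp add: ennreal_le_iff)
      then have "norm (?g - X n) \<le> e / 2"
        by (rule power2_le_imp_le) (use \<open>e > 0\<close> in simp)
      then show ?thesis
        using \<open>e > 0\<close> by (simp add: norm_minus_commute)
    qed
    then show "\<exists>M. \<forall>n\<ge>M. norm (X n - ?g) < e"
      by blast
  qed
  then show ?thesis
    by (rule convergentI)
qed

lemma root_avg_AE_cong:
  assumes "AE z in circle. f z = g z" "n > 0"
  shows "AE z in circle. root_avg n f z = root_avg n g z"
  using AE_roots [OF assms] by eventually_elim (auto simp: root_avg_def intro!: sum.cong)

section \<open>Subspaces of dimension 0 and 1\<close>

lemma has_dim_0_iff: "has_dim V 0 \<longleftrightarrow> V = {0}"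
proof
  assume "V = {0}"
  then show "has_dim V 0"
    unfolding has_dim_def by (intro exI [of _ "{}"]) (simp add: l2.independent_empty)
qed (auto simp: has_dim_def)

lemma has_dim_1_iff: "has_dim V 1 \<longleftrightarrow> (\<exists>x. x \<noteq> 0 \<and> V = range (\<lambda>c. c *\<^sub>C x))"
proof
  assume "has_dim V 1"
  then obtain B where "card B = 1" "\<not> l2.dependent B" "l2.span B = V"
    by (auto simp: has_dim_def)
  then obtain x where "B = {x}"
    by (auto simp: card_1_singleton_iff)
  then show "\<exists>x. x \<noteq> 0 \<and> V = range (\<lambda>c. c *\<^sub>C x)"
    using \<open>\<not> l2.dependent B\<close> \<open>l2.span B = V\<close>
    by (intro exI [of _ x]) (auto simp: l2.dependent_single l2.span_singleton)
next
  assume "\<exists>x. x \<noteq> 0 \<and> V = range (\<lambda>c. c *\<^sub>C x)"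
  then obtain x where "x \<noteq> 0" "V = range (\<lambda>c. c *\<^sub>C x)"
    by blast
  then show "has_dim V 1"
    unfolding has_dim_def
    by (intro exI [of _ "{x}"]) (simp add: l2.dependent_single l2.span_singleton)
qed

lemma has_dim_1_nontrivial:
  assumes "has_dim V 1"
  shows "V \<noteq> {0}"
proof -
  obtain x where x: "x \<noteq> 0" "V = range (\<lambda>c. c *\<^sub>C x)"
    using assms unfolding has_dim_1_iff by blast
  have "1 *\<^sub>C x \<in> V"
    unfolding x(2) by (rule rangeI)
  then show ?thesis
    using x(1) by auto
qed

lemma square_integrable_circle_valued:
  assumes "\<xi> \<in> circle \<rightarrow>\<^sub>M circle"
  shows "square_integrable \<xi>"
proof -
  have "\<xi> \<in> circle \<rightarrow>\<^sub>M restrict_space borel (sphere 0 1)"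
    using assms unfolding measurable_cong_sets [OF refl sets_circle] .
  then have "\<xi> \<in> borel_measurable circle"
    by (rule measurable_restrict_space2_iff [THEN iffD1, THEN conjunct1])
  moreover have "cmod (\<xi> z) = 1" if "z \<in> space circle" for z
    using measurable_space [OF assms that] by simp
  then have "integrable circle (\<lambda>z. (cmod (\<xi> z))\<^sup>2) \<longleftrightarrow> integrable circle (\<lambda>z. 1 :: real)"
    by (intro Bochner_Integration.integrable_cong) auto
  ultimately show ?thesis
    by (simp add: square_integrable_def)
qed

lemma AE_circle_nontrivial: "\<not> (AE z in circle. False)"
proof -
  have "(AE z in circle. False) \<longleftrightarrow> emeasure circle (space circle) = 0"
    by (rule AE_iff_measurable [OF sets.top]) auto
  then show ?thesis
    by (simp add: emeasure_circle)
qed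

lemma borel_measurable_cnj [measurable (raw)]:
  "f \<in> borel_measurable M \<Longrightarrow> (\<lambda>x. cnj (f x)) \<in> borel_measurable M"
  by (rule measurable_compose [OF _ borel_measurable_continuous_onI]) (auto intro: continuous_intros)

section \<open>The weighted composition operator\<close>

locale normalized_weight =
  fixes N :: nat and m :: "complex \<Rightarrow> complex"
  assumes N: "N \<ge> 2"
    and measurable_m [measurable]: "m \<in> borel_measurable circle"
    and normalized: "AE z in circle. (1 / real N) * (\<Sum>w | w ^ N = z. (cmod (m w))\<^sup>2) = 1"
begin

abbreviation S :: "l2_circle \<Rightarrow> l2_circle" where
  "S \<equiv> weighted_comp N m"

lemma N_pos [simp]: "N > 0"
  using N by simp

text \<open>On the fibre over \<open>z\<close> the factor \<open>\<xi> (w ^ N)\<close> is the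
  constant \<open>\<xi> z\<close>, and the squared weights sum to \<open>N\<close>. Summing over
  fibres thus shows that the squared norm is unchanged.\<close>

lemma square_integrable_weighted:
  assumes "square_integrable \<xi>"
  shows "square_integrable (\<lambda>z. m z * \<xi> (z ^ N))"
proof -
  have [measurable]: "\<xi> \<in> borel_measurable circle"
    using assms by (simp add: square_integrable_def)
  let ?f = "\<lambda>z. ennreal ((cmod (m z * \<xi> (z ^ N)))\<^sup>2)"
  have "of_nat N * (\<integral>\<^sup>+z. ?f z \<partial>circle) = (\<integral>\<^sup>+z. (\<Sum>w | w ^ N = z. ?f w) \<partial>circle)"
    by (subst nn_integral_sum_roots) auto
  also have "\<dots> = (\<integral>\<^sup>+z. of_nat N * ennreal ((cmod (\<xi> z))\<^sup>2) \<partial>circle)"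
  proof (rule nn_integral_cong_AE)
    show "AE z in circle. (\<Sum>w | w ^ N = z. ?f w) = of_nat N * ennreal ((cmod (\<xi> z))\<^sup>2)"
      using normalized
    proof eventually_elim
      case (elim z)
      have "(\<Sum>w | w ^ N = z. ?f w) = (\<Sum>w | w ^ N = z. ennreal ((cmod (m w))\<^sup>2 * (cmod (\<xi> z))\<^sup>2))"
        by (intro sum.cong) (auto simp: norm_mult power_mult_distrib)
      also have "\<dots> = ennreal ((\<Sum>w | w ^ N = z. (cmod (m w))\<^sup>2) * (cmod (\<xi> z))\<^sup>2)"
        by (simp add: sum_distrib_right)
      also have "(\<Sum>w | w ^ N = z. (cmod (m w))\<^sup>2) = real N"
        using elim N by (simp add: field_simps)
      finally show ?case
        by (simp add: ennreal_mult ennreal_of_nat_eq_real_of_nat)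
    qed
  qed
  also have "\<dots> = of_nat N * (\<integral>\<^sup>+z. ennreal ((cmod (\<xi> z))\<^sup>2) \<partial>circle)"
    by (rule nn_integral_cmult) measurable
  finally have "(\<integral>\<^sup>+z. ?f z \<partial>circle) = (\<integral>\<^sup>+z. ennreal ((cmod (\<xi> z))\<^sup>2) \<partial>circle)"
    using N by (simp add: ennreal_mult_cancel_left)
  also have "\<dots> < \<infinity>"
    using assms by (simp add: square_integrable_def integrable_iff_bounded)
  finally have "(\<integral>\<^sup>+z. ?f z \<partial>circle) < \<infinity>" .
  then show ?thesis
    unfolding square_integrable_def by (intro conjI integrableI_bounded) simp_all
qed

lemma AE_rep_S:
  "AE z in circle. rep_l2_circle (S x) z = m z * rep_l2_circle x (z ^ N)"
  unfolding weighted_comp_def by (intro AE_rep_abs square_integrable_weighted square_integrable_rep)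

text \<open>Two representatives of a class differ on a null set, whose preimage under the power map
  is null by \<open>AE_power\<close>; so the choice inside \<open>weighted_comp\<close> is
  immaterial.\<close>

lemma weighted_comp_abs:
  assumes "square_integrable \<xi>"
  shows "S (abs_l2_circle \<xi>) = abs_l2_circle (\<lambda>z. m z * \<xi> (z ^ N))"
  unfolding weighted_comp_def
  using AE_power [OF AE_rep_abs [OF assms] N_pos]
  by (subst abs_l2_circle_eq_iff)
     (auto intro!: square_integrable_weighted square_integrable_rep assms elim: eventually_mono)

lemma S_add: "S (x + y) = S x + S y"
proof (rule l2_eqI)
  show "AE z in circle. rep_l2_circle (S (x + y)) z = rep_l2_circle (S x + S y) z"
    using AE_rep_S [of "x + y"] AE_rep_S [of x] AE_rep_S [of y] AE_rep_add [of "S x" "S y"]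
      AE_power [OF AE_rep_add [of x y] N_pos]
    by eventually_elim (simp add: distrib_left)
qed

lemma S_scaleC: "S (c *\<^sub>C x) = c *\<^sub>C S x"
proof (rule l2_eqI)
  show "AE z in circle. rep_l2_circle (S (c *\<^sub>C x)) z = rep_l2_circle (c *\<^sub>C S x) z"
    using AE_rep_S [of "c *\<^sub>C x"] AE_rep_S [of x] AE_rep_scaleC [of c "S x"]
      AE_power [OF AE_rep_scaleC [of c x] N_pos]
    by eventually_elim simp
qed

text \<open>Both representatives carry the same factor \<open>m w\<close>, so only its squared
  modulus survives in the product. Integrating gives the isometry property, iterating gives the
  formula for powers.\<close>

lemma root_avg_S:
  "AE z in circle. root_avg N (\<lambda>w. rep_l2_circle (S x) w * cnj (rep_l2_circle (S y) w)) z =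
     rep_l2_circle x z * cnj (rep_l2_circle y z)"
  using AE_roots [OF AE_rep_S [of x] N_pos] AE_roots [OF AE_rep_S [of y] N_pos] normalized
proof eventually_elim
  case (elim z)
  have "(\<Sum>w | w ^ N = z. rep_l2_circle (S x) w * cnj (rep_l2_circle (S y) w)) =
      (\<Sum>w | w ^ N = z. complex_of_real ((cmod (m w))\<^sup>2) * (rep_l2_circle x z * cnj (rep_l2_circle y z)))"
  proof (rule sum.cong [OF refl])
    fix w
    assume "w \<in> {w. w ^ N = z}"
    then have "rep_l2_circle (S x) w = m w * rep_l2_circle x z" "rep_l2_circle (S y) w = m w * rep_l2_circle y z"
      using elim(1,2) by auto
    then show "rep_l2_circle (S x) w * cnj (rep_l2_circle (S y) w) =
        complex_of_real ((cmod (m w))\<^sup>2) * (rep_l2_circle x z * cnj (rep_l2_circle y z))"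
      by (simp only: complex_norm_square complex_cnj_mult mult_ac)
  qed
  also have "\<dots> = complex_of_real (\<Sum>w | w ^ N = z. (cmod (m w))\<^sup>2) * (rep_l2_circle x z * cnj (rep_l2_circle y z))"
    by (simp add: sum_distrib_right)
  also have "(\<Sum>w | w ^ N = z. (cmod (m w))\<^sup>2) = real N"
    using elim(3) N by (simp add: field_simps)
  finally show ?case
    using N by (simp add: root_avg_def scaleR_conv_of_real)
qed

lemma integrable_rep_mult: "integrable circle (\<lambda>z. rep_l2_circle x z * cnj (rep_l2_circle y z))"
  by (intro integrable_mult_cnj square_integrable_rep)

lemma cinner_S: "cinner (S x) (S y) = cinner x y"
proof -
  have "cinner (S x) (S y) =
      (\<integral>z. root_avg N (\<lambda>w. rep_l2_circle (S x) w * cnj (rep_l2_circle (S y) w)) z \<partial>circle)"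
    by (simp add: cinner_eq integral_root_avg integrable_rep_mult)
  also have "\<dots> = cinner x y"
    unfolding cinner_eq
    by (rule integral_cong_AE) (auto intro!: root_avg_S borel_measurable_integrable integrable_root_avg integrable_rep_mult)
  finally show ?thesis .
qed

lemma norm_S: "norm (S x) = norm x"
  by (simp add: norm_l2_circle_def inner_l2_circle_def cinner_S)

lemma isometry_S: "isometry S"
  unfolding isometry_def Vector_Spaces.linear_iff
  by (auto simp: norm_S S_add S_scaleC l2.vector_space_axioms)

text \<open>Read off by averaging the integrand of \<open>cinner (S x) y\<close> over fibres:
  \<open>x\<close> is constant there and factors out.\<close>

definition S_adj :: "l2_circle \<Rightarrow> l2_circle" where
  "S_adj y = abs_l2_circle (root_avg N (\<lambda>w. cnj (m w) * rep_l2_circle y w))"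

text \<open>Cauchy-Schwarz on each fibre: since the squared weights sum to \<open>N\<close>, the
  squared average is at most the average of the squared modulus of \<open>y\<close>.\<close>

lemma square_integrable_S_adj:
  "square_integrable (root_avg N (\<lambda>w. cnj (m w) * rep_l2_circle y w))"
proof -
  let ?g = "rep_l2_circle y"
  have meas: "(\<lambda>w. cnj (m w) * ?g w) \<in> borel_measurable circle"
    by measurable
  have [measurable]: "root_avg N (\<lambda>w. cnj (m w) * ?g w) \<in> borel_measurable circle"
    by (intro measurable_root_avg meas N_pos)
  have "integrable circle (root_avg N (\<lambda>w. (cmod (?g w))\<^sup>2))"
    by (intro integrable_root_avg integrable_rep_square N_pos)
  then have "integrable circle (\<lambda>z. (cmod (root_avg N (\<lambda>w. cnj (m w) * ?g w) z))\<^sup>2)"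
  proof (rule Bochner_Integration.integrable_bound)
    show "AE z in circle. norm ((cmod (root_avg N (\<lambda>w. cnj (m w) * ?g w) z))\<^sup>2) \<le>
        norm (root_avg N (\<lambda>w. (cmod (?g w))\<^sup>2) z)"
      using normalized
    proof eventually_elim
      case (elim z)
      let ?R = "{w. w ^ N = z}"
      have m: "(\<Sum>w\<in>?R. (cmod (m w))\<^sup>2) = real N"
        using elim N by (simp add: field_simps)
      have "(cmod (\<Sum>w\<in>?R. cnj (m w) * ?g w))\<^sup>2 \<le> (\<Sum>w\<in>?R. cmod (m w) * cmod (?g w))\<^sup>2"
        by (intro power_mono sum_norm_le) (auto simp: norm_mult)
      also have "\<dots> \<le> (\<Sum>w\<in>?R. (cmod (m w))\<^sup>2) * (\<Sum>w\<in>?R. (cmod (?g w))\<^sup>2)"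
        by (rule Cauchy_Schwarz_ineq_sum)
      finally have "(cmod (\<Sum>w\<in>?R. cnj (m w) * ?g w))\<^sup>2 / (real N)\<^sup>2 \<le>
          (real N * (\<Sum>w\<in>?R. (cmod (?g w))\<^sup>2)) / (real N)\<^sup>2"
        unfolding m by (rule divide_right_mono) simp
      moreover have "(cmod (root_avg N (\<lambda>w. cnj (m w) * ?g w) z))\<^sup>2 =
          (cmod (\<Sum>w\<in>?R. cnj (m w) * ?g w))\<^sup>2 / (real N)\<^sup>2"
        by (simp add: root_avg_def power_divide norm_divide)
      moreover have "root_avg N (\<lambda>w. (cmod (?g w))\<^sup>2) z = (real N * (\<Sum>w\<in>?R. (cmod (?g w))\<^sup>2)) / (real N)\<^sup>2"
        using N by (simp add: root_avg_def power2_eq_square)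
      ultimately show ?case
        unfolding real_norm_def abs_power2 by (metis abs_ge_self order_trans)
    qed
  qed measurable
  then show ?thesis
    by (simp add: square_integrable_def)
qed

lemma cinner_S_adj: "cinner (S x) y = cinner x (S_adj y)"
proof -
  let ?f = "rep_l2_circle x" and ?g = "rep_l2_circle y"
  have "cinner (S x) y = (\<integral>z. root_avg N (\<lambda>w. rep_l2_circle (S x) w * cnj (?g w)) z \<partial>circle)"
    by (simp add: cinner_eq integral_root_avg integrable_rep_mult)
  also have "\<dots> = cinner x (S_adj y)"
    unfolding cinner_eq
  proof (rule integral_cong_AE)
    show "AE z in circle. root_avg N (\<lambda>w. rep_l2_circle (S x) w * cnj (?g w)) z =
        ?f z * cnj (rep_l2_circle (S_adj y) z)"
      using AE_roots [OF AE_rep_S [of x] N_pos] AE_rep_abs [OF square_integrable_S_adj [of y]]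
    proof eventually_elim
      case (elim z)
      have "(\<Sum>w | w ^ N = z. rep_l2_circle (S x) w * cnj (?g w)) =
          (\<Sum>w | w ^ N = z. ?f z * cnj (cnj (m w) * ?g w))"
        using elim(1) by (intro sum.cong) auto
      then show ?case
        unfolding S_adj_def elim(2)
        by (simp add: root_avg_def sum_distrib_left)
    qed
  qed (auto intro!: borel_measurable_integrable integrable_root_avg integrable_rep_mult)
  finally show ?thesis .
qed

text \<open>The definite description in \<open>cadjoint\<close> needs uniqueness, for which the real
  part of \<open>cinner\<close> already separates vectors.\<close>

lemma cadjoint_S: "cadjoint S = S_adj"
  unfolding cadjoint_def
proof (rule the_equality)
  fix T
  assume T: "\<forall>f g. cinner (S f) g = cinner f (T g)"
  show "T = S_adj"
  proof
    fix y
    have "f \<bullet> T y = f \<bullet> S_adj y" for f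
      using T by (simp add: inner_l2_circle_def flip: cinner_S_adj)
    then show "T y = S_adj y"
      by (metis vector_eq_ldot)
  qed
qed (simp add: cinner_S_adj)

sublocale S: adjoint_isometry S S_adj
  by unfold_locales (simp_all add: S_add S_scaleC scaleR_l2_circle_def norm_S inner_l2_circle_def cinner_S_adj)

section \<open>The unitary part and its dimension\<close>

definition unitary_part :: "l2_circle set" where
  "unitary_part = (\<Inter>k. range (S ^^ k))"

lemma range_wold_unitary_proj: "range (wold_unitary_proj S) = unitary_part"
  using S.range_lim_range_proj [OF l2_circle_complete]
  by (simp add: unitary_part_def wold_unitary_proj_def [abs_def] cadjoint_S S.range_proj_def)

lemma funpow_S_scaleC: "(S ^^ k) (c *\<^sub>C x) = c *\<^sub>C (S ^^ k) x"
  by (induction k) (simp_all add: S_scaleC)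

lemma funpow_S_add: "(S ^^ k) (x + y) = (S ^^ k) x + (S ^^ k) y"
  by (induction k) (simp_all add: S_add)

lemma unitary_part_preimages:
  assumes "x \<in> unitary_part"
  shows "\<exists>v. \<forall>k. x = (S ^^ k) (v k)"
  using assms by (intro choice) (auto simp: unitary_part_def)

lemma unitary_part_add:
  assumes "x \<in> unitary_part" "y \<in> unitary_part"
  shows "x + y \<in> unitary_part"
proof -
  obtain u where "\<forall>k. x = (S ^^ k) (u k)"
    using unitary_part_preimages [OF assms(1)] by blast
  moreover obtain v where "\<forall>k. y = (S ^^ k) (v k)"
    using unitary_part_preimages [OF assms(2)] by blast
  ultimately have "x + y = (S ^^ k) (u k + v k)" for k
    by (simp add: funpow_S_add)
  then show ?thesis
    unfolding unitary_part_def by blast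
qed

lemma unitary_part_scaleC:
  assumes "x \<in> unitary_part"
  shows "c *\<^sub>C x \<in> unitary_part"
proof -
  obtain u where "\<forall>k. x = (S ^^ k) (u k)"
    using unitary_part_preimages [OF assms] by blast
  then have "c *\<^sub>C x = (S ^^ k) (c *\<^sub>C u k)" for k
    by (simp add: funpow_S_scaleC)
  then show ?thesis
    unfolding unitary_part_def by blast
qed

lemma unitary_part_S:
  assumes "x \<in> unitary_part"
  shows "S x \<in> unitary_part"
  unfolding unitary_part_def
proof
  fix k
  obtain y where "x = (S ^^ k) y"
    using assms by (auto simp: unitary_part_def)
  then have "S x = (S ^^ k) (S y)"
    by (simp add: funpow_swap1)
  then show "S x \<in> range (S ^^ k)"
    by blast
qed

lemma root_avg_funpow_S:
  "AE z in circle. root_avg (N ^ k) (\<lambda>w. rep_l2_circle ((S ^^ k) x) w * cnj (rep_l2_circle ((S ^^ k) y) w)) z =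
     rep_l2_circle x z * cnj (rep_l2_circle y z)"
proof (induction k)
  case 0
  show ?case
    by (simp add: root_avg_def)
next
  case (Suc k)
  let ?h = "\<lambda>k w. rep_l2_circle ((S ^^ k) x) w * cnj (rep_l2_circle ((S ^^ k) y) w)"
  \<comment> \<open>The inner average removes the outermost application of S, leaving the induction
    hypothesis.\<close>
  have "AE z in circle. root_avg (N ^ k) (root_avg N (?h (Suc k))) z = root_avg (N ^ k) (?h k) z"
    using root_avg_S [of "(S ^^ k) x" "(S ^^ k) y"] by (intro root_avg_AE_cong) auto
  with Suc show ?case
    by eventually_elim (simp add: root_avg_root_avg mult.commute)
qed

lemma power_N_at_top: "filterlim (\<lambda>k. N ^ k) at_top sequentially"
  using N by (intro filterlim_subseq strict_monoI) (auto intro: power_strict_increasing)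

text \<open>As \<open>N \<ge> 2\<close>, the powers \<open>N ^ k\<close> are unbounded and
  equidistribution applies along them. The averages enter through any almost-everywhere equal
  \<open>h k\<close>: products of preimages below, a constant sequence for an eigenvector.\<close>

lemma deviation_tendsto_0:
  assumes h: "\<And>k. AE z in circle. root_avg (N ^ k) (\<lambda>w. rep_l2_circle x w * cnj (rep_l2_circle y w)) z = h k z"
    and [measurable]: "\<And>k. h k \<in> borel_measurable circle"
  shows "(\<lambda>k. \<integral>z. cmod (h k z - cinner x y) \<partial>circle) \<longlonglongrightarrow> 0"
proof -
  let ?f = "\<lambda>w. rep_l2_circle x w * cnj (rep_l2_circle y w)"
  have "(\<integral>z. cmod (root_avg (N ^ k) ?f z - cinner x y) \<partial>circle) = (\<integral>z. cmod (h k z - cinner x y) \<partial>circle)" for k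
  proof (rule integral_cong_AE)
    show "(\<lambda>z. cmod (root_avg (N ^ k) ?f z - cinner x y)) \<in> borel_measurable circle"
      by (auto intro!: borel_measurable_integrable integrable_root_avg integrable_rep_mult
        Bochner_Integration.integrable_diff integrable_norm)
  qed (use h [of k] in \<open>auto elim: eventually_mono\<close>)
  then show ?thesis
    using filterlim_compose [OF equidist [OF integrable_rep_mult, unfolded equidist_def] power_N_at_top, of x y]
    by (simp add: cinner_eq)
qed

text \<open>L1 convergence gives no pointwise limit directly. Instead of passing to subsequences,
  the proof integrates one pointwise inequality: the three deviations sum to at least 1
  everywhere.\<close>

lemma unitary_part_not_orthogonal:
  assumes x: "x \<in> unitary_part" "norm x = 1" and y: "y \<in> unitary_part" "norm y = 1"
  shows "cinner x y \<noteq> 0"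
proof
  assume orth: "cinner x y = 0"
  obtain \<xi> where \<xi>: "\<forall>k. x = (S ^^ k) (\<xi> k)"
    using unitary_part_preimages [OF x(1)] by blast
  obtain \<eta> where \<eta>: "\<forall>k. y = (S ^^ k) (\<eta> k)"
    using unitary_part_preimages [OF y(1)] by blast
  have avg: "AE z in circle. root_avg (N ^ k) (\<lambda>w. rep_l2_circle x w * cnj (rep_l2_circle y w)) z =
      rep_l2_circle (\<xi> k) z * cnj (rep_l2_circle (\<eta> k) z)"
    "AE z in circle. root_avg (N ^ k) (\<lambda>w. rep_l2_circle x w * cnj (rep_l2_circle x w)) z =
      rep_l2_circle (\<xi> k) z * cnj (rep_l2_circle (\<xi> k) z)"
    "AE z in circle. root_avg (N ^ k) (\<lambda>w. rep_l2_circle y w * cnj (rep_l2_circle y w)) z =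
      rep_l2_circle (\<eta> k) z * cnj (rep_l2_circle (\<eta> k) z)" for k
    using root_avg_funpow_S [of k "\<xi> k" "\<eta> k"] root_avg_funpow_S [of k "\<xi> k" "\<xi> k"]
      root_avg_funpow_S [of k "\<eta> k" "\<eta> k"] \<xi> [rule_format, of k, symmetric] \<eta> [rule_format, of k, symmetric]
    by (simp_all only:)
  let ?u = "\<lambda>k. rep_l2_circle (\<xi> k)" and ?v = "\<lambda>k. rep_l2_circle (\<eta> k)"
  have xy: "(\<lambda>k. \<integral>z. cmod (?u k z * cnj (?v k z)) \<partial>circle) \<longlonglongrightarrow> 0"
    using deviation_tendsto_0 [OF avg(1)] by (simp add: orth)
  have xx: "(\<lambda>k. \<integral>z. cmod (?u k z * cnj (?u k z) - 1) \<partial>circle) \<longlonglongrightarrow> 0"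
    using deviation_tendsto_0 [OF avg(2)] by (simp add: cinner_self x(2))
  have yy: "(\<lambda>k. \<integral>z. cmod (?v k z * cnj (?v k z) - 1) \<partial>circle) \<longlonglongrightarrow> 0"
    using deviation_tendsto_0 [OF avg(3)] by (simp add: cinner_self y(2))
  have "(\<lambda>k. (\<integral>z. cmod (?u k z * cnj (?v k z)) \<partial>circle) + (\<integral>z. cmod (?u k z * cnj (?u k z) - 1) \<partial>circle) +
      (\<integral>z. cmod (?v k z * cnj (?v k z) - 1) \<partial>circle)) \<longlonglongrightarrow> 0 + 0 + 0"
    by (intro tendsto_add xy xx yy)
  moreover have "1 \<le> (\<integral>z. cmod (?u k z * cnj (?v k z)) \<partial>circle) +
      (\<integral>z. cmod (?u k z * cnj (?u k z) - 1) \<partial>circle) + (\<integral>z. cmod (?v k z * cnj (?v k z) - 1) \<partial>circle)" for k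
  proof -
    have bound: "1 \<le> cmod (a * cnj b) + cmod (a * cnj a - 1) + cmod (b * cnj b - 1)" for a b
    proof -
      \<comment> \<open>The squared modulus minus 1 has the factor \<open>cmod c + 1\<close>, which
        is at least 1, so dropping it compares moduli instead of their squares.\<close>
      have *: "\<bar>1 - r\<bar> \<le> cmod (c * cnj c - 1)" if "r = cmod c" for c r
      proof -
        have "c * cnj c - 1 = complex_of_real ((cmod c)\<^sup>2 - 1)"
          by (simp flip: complex_norm_square)
        then have "cmod (c * cnj c - 1) = \<bar>(cmod c)\<^sup>2 - 1\<bar>"
          by (simp only: norm_of_real)
        also have "(cmod c)\<^sup>2 - 1 = (cmod c - 1) * (cmod c + 1)"
          by (simp add: power2_eq_square algebra_simps)
        also have "\<bar>\<dots>\<bar> = \<bar>1 - cmod c\<bar> * (cmod c + 1)"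
          by (simp add: abs_mult abs_minus_commute)
        finally show ?thesis
          using mult_left_mono [of 1 "cmod c + 1" "\<bar>1 - cmod c\<bar>"] that by simp
      qed
      have "1 - u * v \<le> \<bar>1 - u\<bar> + \<bar>1 - v\<bar>" if "u \<ge> 0" "v \<ge> 0" for u v :: real
      proof (cases "u \<le> 1")
        case True
        have "u * (1 - v) \<le> u * \<bar>1 - v\<bar>"
          using that by (intro mult_left_mono) auto
        also have "\<dots> \<le> 1 * \<bar>1 - v\<bar>"
          using True by (intro mult_right_mono) auto
        finally have "u * (1 - v) \<le> \<bar>1 - v\<bar>"
          by simp
        moreover have "1 - u * v = (1 - u) + u * (1 - v)"
          by (simp add: algebra_simps)
        ultimately show ?thesis
          by linarith
      next
        case False
        then have "1 * v \<le> u * v"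
          using that by (intro mult_right_mono) auto
        then show ?thesis
          by simp
      qed
      from this [of "cmod a" "cmod b"] show ?thesis
        using * [of "cmod a" a] * [of "cmod b" b] by (simp add: norm_mult)
    qed
    have int [simp]: "integrable circle (\<lambda>z. cmod (?u k z * cnj (?v k z)))"
      "integrable circle (\<lambda>z. cmod (?u k z * cnj (?u k z) - 1))"
      "integrable circle (\<lambda>z. cmod (?v k z * cnj (?v k z) - 1))"
      by (intro integrable_norm Bochner_Integration.integrable_diff integrable_rep_mult integrable_circle_const)+
    have "(\<integral>z. 1 \<partial>circle) \<le> (\<integral>z. cmod (?u k z * cnj (?v k z)) + cmod (?u k z * cnj (?u k z) - 1) +
        cmod (?v k z * cnj (?v k z) - 1) \<partial>circle)"
    proof (rule integral_mono)
      show "1 \<le> cmod (?u k z * cnj (?v k z)) + cmod (?u k z * cnj (?u k z) - 1) +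
          cmod (?v k z * cnj (?v k z) - 1)" for z
        by (rule bound)
    qed simp_all
    then show ?thesis
      by (simp only: Bochner_Integration.integral_add Bochner_Integration.integrable_add int) simp
  qed
  ultimately have "1 \<le> (0 + 0 + 0 :: real)"
    by (intro LIMSEQ_le_const) auto
  then show False
    by simp
qed

lemma unitary_part_cases:
  obtains "unitary_part = {0}"
  | x where "norm x = 1" "unitary_part = range (\<lambda>c. c *\<^sub>C x)"
proof (cases "unitary_part \<subseteq> {0}")
  case True
  have "0 \<in> unitary_part"
    by (auto simp: unitary_part_def image_iff intro!: exI [of _ 0])
      (metis S.A_S_funpow S.funpow_adjoint_isometry adjoint_isometry.iso norm_eq_zero)
  then show thesis
    using True that(1) by blast
next
  case False
  then obtain x' where x': "x' \<in> unitary_part" "x' \<noteq> 0"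
    by blast
  have normalize: "norm (complex_of_real (1 / norm v) *\<^sub>C v) = 1" if "v \<noteq> 0" for v
    using that by (simp add: norm_scaleC norm_divide)
  define x where "x = complex_of_real (1 / norm x') *\<^sub>C x'"
  have x: "norm x = 1" "x \<in> unitary_part"
    unfolding x_def using x' normalize unitary_part_scaleC by auto
  have "y = cinner y x *\<^sub>C x" if y: "y \<in> unitary_part" for y
  proof (rule ccontr)
    assume *: "y \<noteq> cinner y x *\<^sub>C x"
    \<comment> \<open>Gram-Schmidt: \<open>w\<close> stays in the unitary part and is orthogonal to
      \<open>x\<close>, so it must vanish. Writing it as a sum fits the closure lemmas.\<close>
    define w where "w = y + (- cinner y x) *\<^sub>C x"
    have "w = y - cinner y x *\<^sub>C x"
      by (simp add: w_def l2.scale_minus_left)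
    then have "w \<noteq> 0"
      using * by simp
    have "w \<in> unitary_part"
      unfolding w_def by (intro unitary_part_add unitary_part_scaleC x y)
    moreover have "cinner w x = 0"
      unfolding w_def cinner_add_left cinner_scaleC_left cinner_self x by simp
    ultimately show False
      using unitary_part_not_orthogonal [OF _ normalize [OF \<open>w \<noteq> 0\<close>] x(2,1)]
      by (simp add: unitary_part_scaleC cinner_scaleC_left)
  qed
  then have "unitary_part = range (\<lambda>c. c *\<^sub>C x)"
    using unitary_part_scaleC [OF x(2)] by blast
  then show thesis
    using x(1) that(2) by blast
qed

section \<open>Eigenfunctions and coboundaries\<close>

lemma unitary_part_eigenvector:
  assumes x: "norm x = 1" "unitary_part = range (\<lambda>c. c *\<^sub>C x)"
  shows "AE z in circle. cmod (m z) = 1"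
    and "\<exists>\<xi> \<in> circle \<rightarrow>\<^sub>M circle. \<exists>lam. cmod lam = 1 \<and>
      (AE z in circle. m z * \<xi> (z ^ N) = lam * \<xi> z)"
proof -
  let ?f = "rep_l2_circle x"
  have "x \<in> unitary_part"
    using x(2) by (metis l2.scale_one rangeI)
  then have "S x \<in> range (\<lambda>c. c *\<^sub>C x)"
    using unitary_part_S x(2) by blast
  then obtain lam where lam: "S x = lam *\<^sub>C x"
    by blast
  have "cmod lam = 1"
    using norm_S [of x] x(1) by (simp add: lam norm_scaleC)
  have eigen: "AE z in circle. m z * ?f (z ^ N) = lam * ?f z"
    using AE_rep_S [of x] AE_rep_scaleC [of lam x] unfolding lam by eventually_elim simp
  have funpow: "(S ^^ k) x = lam ^ k *\<^sub>C x" for k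
    by (induction k) (simp_all add: S_scaleC lam mult.commute)
  let ?h = "\<lambda>w. ?f w * cnj (?f w)"
  \<comment> \<open>The unimodular factor \<open>lam ^ k\<close> disappears from \<open>?h\<close>,
    so every one of these averages returns the squared modulus of \<open>x\<close>
    unchanged.\<close>
  have "AE z in circle. root_avg (N ^ k) ?h z = ?h z" for k
  proof -
    have "AE w in circle. rep_l2_circle ((S ^^ k) x) w * cnj (rep_l2_circle ((S ^^ k) x) w) = ?h w"
      unfolding funpow using AE_rep_scaleC [of "lam ^ k" x]
    proof eventually_elim
      case (elim z)
      have "lam ^ k * cnj (lam ^ k) = 1"
        using \<open>cmod lam = 1\<close> complex_norm_square [of "lam ^ k"] by (simp add: norm_power)
      then show ?case
        unfolding elim by (simp add: mult_ac)
    qed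
    from root_avg_AE_cong [OF this, of "N ^ k"] root_avg_funpow_S [of k x x] show ?thesis
      by auto
  qed
  then have "(\<lambda>k::nat. \<integral>z. cmod (?h z - cinner x x) \<partial>circle) \<longlonglongrightarrow> 0"
    by (rule deviation_tendsto_0) measurable
  \<comment> \<open>A constant sequence tending to 0 is 0.\<close>
  then have "(\<integral>z. cmod (?h z - 1) \<partial>circle) = 0"
    by (simp add: cinner_self x(1) LIMSEQ_const_iff)
  then have "AE z in circle. cmod (?h z - 1) = 0"
    by (subst (asm) integral_nonneg_eq_0_iff_AE) (auto intro!: integrable_norm integrable_rep_mult)
  then have unimod: "AE z in circle. cmod (?f z) = 1"
  proof eventually_elim
    case (elim z)
    then have "complex_of_real ((cmod (?f z))\<^sup>2) = 1"
      by (simp only: complex_norm_square) simp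
    then have "(cmod (?f z))\<^sup>2 = 1"
      by (simp only: of_real_eq_1_iff)
    then show ?case
      using norm_ge_zero [of "?f z"] by (auto simp: power2_eq_1_iff)
  qed
  show "AE z in circle. cmod (m z) = 1"
    using eigen unimod AE_power [OF unimod N_pos]
  proof eventually_elim
    case (elim z)
    then have "cmod (m z * ?f (z ^ N)) = cmod (lam * ?f z)"
      by simp
    then show ?case
      using elim(2,3) \<open>cmod lam = 1\<close> by (simp add: norm_mult)
  qed
  \<comment> \<open>The representative is unimodular only almost everywhere, whereas a map into
    \<open>circle\<close> must be so at every point of the circle; the value 1 repairs the
    exceptional set.\<close>
  define \<xi> where "\<xi> z = (if cmod (?f z) = 1 then ?f z else 1)" for z
  have "\<xi> \<in> circle \<rightarrow>\<^sub>M restrict_space borel (sphere 0 1)"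
    unfolding \<xi>_def by (intro measurable_restrict_space2) auto
  then have \<xi>: "\<xi> \<in> circle \<rightarrow>\<^sub>M circle"
    unfolding measurable_cong_sets [OF refl sets_circle] .
  have "AE z in circle. m z * \<xi> (z ^ N) = lam * \<xi> z"
    using eigen unimod AE_power [OF unimod N_pos] by eventually_elim (simp add: \<xi>_def)
  then show "\<exists>\<xi> \<in> circle \<rightarrow>\<^sub>M circle. \<exists>lam. cmod lam = 1 \<and>
      (AE z in circle. m z * \<xi> (z ^ N) = lam * \<xi> z)"
    using \<xi> \<open>cmod lam = 1\<close> by blast
qed

text \<open>An eigenvector with nonzero eigenvalue lies in every range, and the bound on the
  dimension leaves room for nothing else.\<close>

lemma unitary_part_of_eigenfunction:
  assumes \<xi>: "\<xi> \<in> circle \<rightarrow>\<^sub>M circle" and "cmod lam = 1"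
    and eigen: "AE z in circle. m z * \<xi> (z ^ N) = lam * \<xi> z"
  shows "abs_l2_circle \<xi> \<noteq> 0" "unitary_part = range (\<lambda>c. c *\<^sub>C abs_l2_circle \<xi>)"
proof -
  let ?x = "abs_l2_circle \<xi>"
  have sq: "square_integrable \<xi>"
    using \<xi> by (rule square_integrable_circle_valued)
  show nz: "?x \<noteq> 0"
  proof
    assume "?x = 0"
    then have "AE z in circle. \<xi> z = 0"
      using sq by (simp add: zero_l2_circle_def abs_l2_circle_eq_iff square_integrable_zero)
    then have "AE z in circle. False"
      using AE_space
    proof eventually_elim
      case (elim z)
      then show ?case
        using measurable_space [OF \<xi>, of z] by simp
    qed
    then show False
      using AE_circle_nontrivial by blast
  qed
  have "S ?x = lam *\<^sub>C ?x"
    using eigen sq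
    by (simp add: weighted_comp_abs scaleC.abs_eq l2_eq_refl abs_l2_circle_eq_iff
        square_integrable_weighted square_integrable_scale)
  then have funpow: "(S ^^ k) ?x = lam ^ k *\<^sub>C ?x" for k
    by (induction k) (simp_all add: S_scaleC mult.commute)
  have "?x = (S ^^ k) (inverse (lam ^ k) *\<^sub>C ?x)" for k
  proof -
    have "lam \<noteq> 0"
      using \<open>cmod lam = 1\<close> by auto
    then show ?thesis
      by (simp add: funpow_S_scaleC funpow)
  qed
  then have mem: "?x \<in> unitary_part"
    unfolding unitary_part_def by blast
  show "unitary_part = range (\<lambda>c. c *\<^sub>C ?x)"
  proof (rule unitary_part_cases)
    assume "unitary_part = {0}"
    then show ?thesis
      using mem nz by blast
  next
    fix x
    assume x: "unitary_part = range (\<lambda>c. c *\<^sub>C x)"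
    then obtain c where c: "?x = c *\<^sub>C x"
      using mem by blast
    \<comment> \<open>Nonzero vectors on one complex line generate the same line, so the abstract
      generator can be exchanged for the eigenfunction.\<close>
    then have "c \<noteq> 0"
      using nz by auto
    then have "x = inverse c *\<^sub>C ?x"
      by (simp add: c)
    then show ?thesis
      using x unitary_part_scaleC [OF mem] by (metis (no_types, lifting) image_subset_iff l2.scale_scale rangeE rangeI subsetI subset_antisym)
  qed
qed

text \<open>A pointwise equivalence: \<open>\<xi> (z ^ N)\<close> has modulus 1 and can be divided
  out, and \<open>cnj lam\<close> is the inverse of \<open>lam\<close>.\<close>

lemma AE_eigen_iff_coboundary:
  assumes \<xi>: "\<xi> \<in> circle \<rightarrow>\<^sub>M circle" and lam: "cmod lam = 1"
  shows "(AE z in circle. m z * \<xi> (z ^ N) = lam * \<xi> z) \<longleftrightarrow>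
    (AE z in circle. cnj lam * m z = \<xi> z * inverse (\<xi> (z ^ N)))"
proof (rule AE_cong)
  fix z
  assume "z \<in> space circle"
  then have "\<xi> (z ^ N) \<noteq> 0"
    using measurable_space [OF \<xi>, of "z ^ N"] by (auto simp: norm_power)
  moreover have "cnj lam * lam = 1"
    using lam by (simp add: mult.commute flip: complex_norm_square)
  ultimately show "m z * \<xi> (z ^ N) = lam * \<xi> z \<longleftrightarrow> cnj lam * m z = \<xi> z * inverse (\<xi> (z ^ N))"
    by (auto simp: field_simps) (metis mult.assoc mult.commute mult.left_commute mult_1)+
qed

end

text \<open>The first conjunct ties the representative-based \<open>weighted_comp\<close> to the
  intended formula on every square integrable function, so the later ones concern that operator and
  not an artefact of the choice.\<close>

theorem theorem3p1:
  fixes N :: nat and m :: "complex \<Rightarrow> complex"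
  assumes "N \<ge> 2"
    and "m \<in> borel_measurable circle"
    and "AE z in circle. (1 / real N) * (\<Sum>w | w ^ N = z. (cmod (m w))\<^sup>2) = 1"
  shows
    "(\<forall>\<xi>. square_integrable \<xi> \<longrightarrow>
        square_integrable (\<lambda>z. m z * \<xi> (z ^ N)) \<and>
        weighted_comp N m (abs_l2_circle \<xi>) = abs_l2_circle (\<lambda>z. m z * \<xi> (z ^ N)))
     \<and> isometry (weighted_comp N m)
     \<and> (has_dim (range (wold_unitary_proj (weighted_comp N m))) 1 \<or>
        has_dim (range (wold_unitary_proj (weighted_comp N m))) 0)
     \<and> (has_dim (range (wold_unitary_proj (weighted_comp N m))) 1 \<longleftrightarrow>
          (AE z in circle. cmod (m z) = 1) \<and>
          (\<exists>\<xi> \<in> measurable circle circle. \<exists>lam. cmod lam = 1 \<and>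
             (AE z in circle. m z * \<xi> (z ^ N) = lam * \<xi> z)))
     \<and> (\<forall>\<xi> \<in> measurable circle circle. \<forall>lam.
          (AE z in circle. cmod (m z) = 1) \<and> cmod lam = 1 \<and>
          (AE z in circle. m z * \<xi> (z ^ N) = lam * \<xi> z) \<longrightarrow>
          range (wold_unitary_proj (weighted_comp N m)) = range (\<lambda>c. c *\<^sub>C abs_l2_circle \<xi>))
     \<and> (is_shift (weighted_comp N m) \<longleftrightarrow>
          \<not> (\<exists>lam. cmod lam = 1 \<and> coboundary N (\<lambda>z. cnj lam * m z)))"
proof -
  interpret normalized_weight N m
    by (rule normalized_weight.intro [OF assms])
  let ?eigen = "\<exists>\<xi> \<in> circle \<rightarrow>\<^sub>M circle. \<exists>lam. cmod lam = 1 \<and>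
      (AE z in circle. m z * \<xi> (z ^ N) = lam * \<xi> z)"
  have dim1: "has_dim unitary_part 1" if eigen: ?eigen
  proof -
    obtain \<xi> lam where "\<xi> \<in> circle \<rightarrow>\<^sub>M circle" "cmod lam = 1"
      "AE z in circle. m z * \<xi> (z ^ N) = lam * \<xi> z"
      using eigen by blast
    note unitary_part_of_eigenfunction [OF this]
    then show ?thesis
      unfolding has_dim_1_iff by blast
  qed
  have dim1D: "(AE z in circle. cmod (m z) = 1) \<and> ?eigen" if "has_dim unitary_part 1"
  proof (rule unitary_part_cases)
    assume "unitary_part = {0}"
    then show ?thesis
      using has_dim_1_nontrivial [OF that] by blast
  next
    fix x
    assume "norm x = 1" "unitary_part = range (\<lambda>c. c *\<^sub>C x)"
    then show ?thesis
      using unitary_part_eigenvector by blast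
  qed
  have dim: "has_dim unitary_part 1 \<or> has_dim unitary_part 0"
  proof (rule unitary_part_cases)
    assume "unitary_part = {0}"
    then show ?thesis
      by (simp add: has_dim_0_iff)
  next
    fix x
    assume x: "norm x = 1" "unitary_part = range (\<lambda>c. c *\<^sub>C x)"
    then have "x \<noteq> 0"
      by auto
    then show ?thesis
      using x(2) has_dim_1_iff by blast
  qed
  have cob: "(\<exists>lam. cmod lam = 1 \<and> coboundary N (\<lambda>z. cnj lam * m z)) \<longleftrightarrow> ?eigen"
    unfolding coboundary_def using AE_eigen_iff_coboundary by blast
  \<comment> \<open>With only dimensions 0 and 1 possible, a trivial intersection of ranges amounts
    to failure of dimension 1.\<close>
  have shift: "is_shift S \<longleftrightarrow> \<not> has_dim unitary_part 1"
    using dim has_dim_1_nontrivial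
    by (auto simp: is_shift_def has_dim_0_iff simp flip: unitary_part_def)
  show ?thesis
    unfolding range_wold_unitary_proj cob shift
  proof (intro conjI allI ballI impI)
    show "square_integrable (\<lambda>z. m z * \<xi> (z ^ N))" if "square_integrable \<xi>" for \<xi>
      using that by (rule square_integrable_weighted)
    show "S (abs_l2_circle \<xi>) = abs_l2_circle (\<lambda>z. m z * \<xi> (z ^ N))" if "square_integrable \<xi>" for \<xi>
      using that by (rule weighted_comp_abs)
    show "unitary_part = range (\<lambda>c. c *\<^sub>C abs_l2_circle \<xi>)"
      if "\<xi> \<in> circle \<rightarrow>\<^sub>M circle"
        "(AE z in circle. cmod (m z) = 1) \<and> cmod lam = 1 \<and>
          (AE z in circle. m z * \<xi> (z ^ N) = lam * \<xi> z)" for \<xi> lam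
      using that unitary_part_of_eigenfunction(2) by blast
    show "has_dim unitary_part 1 \<longleftrightarrow> (AE z in circle. cmod (m z) = 1) \<and> ?eigen"
      using dim1 dim1D by blast
    show "\<not> has_dim unitary_part 1 \<longleftrightarrow> \<not> ?eigen"
      using dim1 dim1D by blast
  qed (rule isometry_S, rule dim)
qed

end
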